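(* Let $\pi\in\Gamma(\wedge^2 T_{\mathbb C}M)$ be a complex Poisson structure on a smooth manifold $M$, with graph $L_\pi=\{\pi^\sharp(\alpha)+\alpha : \alpha\in T^*_{\mathbb C}M\}$. Let $E_\pi=\pi^\sharp(T^*_{\mathbb C}M)$, $\Delta_\pi=E_\pi\cap TM$, and let $\Omega$ be the pointwise complex two-form on $E_\pi$ given by $\Omega(\pi^\sharp\alpha,\pi^\sharp\beta)=\pi(\alpha,\beta)$. Then the quasi-real lagrangian family $\widetilde{L_\pi}$ associated to $L_\pi$ satisfies $$\widetilde{L_\pi}=L\big((\Delta_\pi)_{\mathbb C},\,\Omega|_{(\Delta_\pi)_{\mathbb C}}\big).$$ Moreover, if $\pi$ is strongly regular, i.e. $E_\pi$ and $\Delta_\pi$ are regular distributions (vector bundles), then $\widetilde{L_\pi}$ is a complex Dirac structure.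
   Context: $T_{\mathbb C}M=TM\otimes\mathbb C$, $T^*_{\mathbb C}M=T^*M\otimes\mathbb C$, $\mathbb TM=TM\oplus T^*M$, $\mathbb T_{\mathbb C}M=\mathbb TM\otimes\mathbb C$, with symmetric pairing $\langle X+\xi,Y+\eta\rangle=\tfrac12(\eta(X)+\xi(Y))$ and Courant–Dorfman bracket $[X+\xi,Y+\eta]=[X,Y]+\mathcal L_X\eta-\iota_Yd\xi$, both extended $\mathbb C$-bilinearly. A complex Poisson structure is a complex bivector $\pi\in\Gamma(\wedge^2T_{\mathbb C}M)$ with $[\pi,\pi]=0$ for the complexified Schouten bracket. The sign convention for $\pi^\sharp$ is $\pi(\alpha,\beta)=\alpha(\pi^\sharp\beta)$. A (real, resp. complex) lagrangian family assigns to each $p\in M$ a lagrangian subspace of $\mathbb T_pM$ (resp. $(\mathbb T_{\mathbb C}M)_p$); it need not be smooth. A (complex) Dirac structure is a lagrangian family which is a smooth subbundle and is involutive for the Courant–Dorfman bracket. For a distribution $E$ and a pointwise skew-symmetric bilinear form $\varepsilon$ on $E$, $L(E,\varepsilon)=\{X+\xi : X\in E,\ \xi|_E=\iota_X\varepsilon\}$. For a complex lagrangian family $L$ put $\widehat L=\{X+\xi\in\mathbb TM : \exists\,\eta\in T^*M,\ X+\eta+i\xi\in L\}$ and $\check L=\{X+\xi\in\mathbb TM : \exists\,\eta\in T^*M,\ X+\xi+i\eta\in L\}$, which are real lagrangian families. For lagrangian families, $L_1\star L_2=\{X+\eta_1+\eta_2 : X+\eta_1\in L_1,\ X+\eta_2\in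 L_2\}$ and $z\cdot L=\{X+z\xi : X+\xi\in L\}$ for $z\in\mathbb C$. The complex tangent sum of two real lagrangian families is $L_1\star_{\mathbb C}L_2=(L_1)_{\mathbb C}\star(i\cdot(L_2)_{\mathbb C})$, and the quasi-real lagrangian family associated to $L$ is $\widetilde L=\check L\star_{\mathbb C}\widehat L$. *)

theory Defs
  imports "HOL-Analysis.Analysis"
begin

section \<open>Smooth functions and smooth manifolds\<close>

text \<open>The next two notions are only used on open sets.\<close>

primrec Ck_on :: "nat \<Rightarrow> 'x::real_normed_vector set \<Rightarrow> ('x \<Rightarrow> 'y::real_normed_vector) \<Rightarrow> bool" where
  "Ck_on 0 S f \<longleftrightarrow> continuous_on S f"
| "Ck_on (Suc k) S f \<longleftrightarrow>
     (\<forall>x\<in>S. f differentiable (at x)) \<and> (\<forall>v. Ck_on k S (\<lambda>x. frechet_derivative f (at x) v))"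

definition smooth_on :: "'x::real_normed_vector set \<Rightarrow> ('x \<Rightarrow> 'y::real_normed_vector) \<Rightarrow> bool" where
  "smooth_on S f \<longleftrightarrow> (\<forall>k. Ck_on k S f)"

text \<open>
  A chart is a pair of its domain and its coordinate map. The manifold \<open>M\<close> is the whole
  type \<open>'a\<close> with its topology, together with an atlas. The atlas need not be maximal: all notions
  below depend only on the smooth structure it generates.
\<close>

type_synonym ('a, 'n) chart = "'a set \<times> ('a \<Rightarrow> real^'n)"

definition chart_inv :: "('a, 'n::finite) chart \<Rightarrow> real^'n \<Rightarrow> 'a" where
  "chart_inv c = inv_into (fst c) (snd c)"

definition is_chart :: "('a::topological_space, 'n::finite) chart \<Rightarrow> bool" where
  "is_chart c \<longleftrightarrow> open (fst c) \<and> open (snd c ` fst c) \<and>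
     homeomorphism (fst c) (snd c ` fst c) (snd c) (chart_inv c)"

definition smooth_manifold ::
  "('a::{t2_space, second_countable_topology}, 'n::finite) chart set \<Rightarrow> bool" where
  "smooth_manifold A \<longleftrightarrow>
     (\<forall>c\<in>A. is_chart c) \<and> (\<Union>c\<in>A. fst c) = UNIV \<and>
     (\<forall>c\<in>A. \<forall>d\<in>A. smooth_on (snd c ` (fst c \<inter> fst d)) (snd d \<circ> chart_inv c))"

section \<open>Tangent and cotangent spaces, and sections of the associated bundles\<close>

text \<open>
  A tangent vector at \<open>p\<close> is an equivalence class of pairs (chart at \<open>p\<close>, coordinate vector),
  where a change of chart multiplies the vector by the Jacobian matrix. Each class has exactly
  one representative whose chart is the chosen chart \<open>chart_at A p\<close>, so the fibres of \<open>TM\<close>,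
  \<open>T\<^sub>\<complex>M\<close> are \<open>real^'n\<close>, \<open>complex^'n\<close>. In the same way \<open>T*M\<close>, \<open>T*\<^sub>\<complex>M\<close> have fibres
  \<open>real^'n\<close>, \<open>complex^'n\<close> (coordinates in the dual basis \<open>dx\<^sup>i\<close>, so that a covector is
  evaluated on a vector by \<open>scalar_product\<close>, which is bilinear and not hermitian), and a complex
  bivector is its skew matrix \<open>\<pi>(dx\<^sup>i, dx\<^sup>j)\<close>. The choice made at one point is unrelated to the
  choice at nearby points; smoothness is tested in the charts of the atlas after converting
  the fibre coordinates with the Jacobian matrices.
\<close>

definition chart_at :: "('a, 'n::finite) chart set \<Rightarrow> 'a \<Rightarrow> ('a, 'n) chart" where
  "chart_at A p = (SOME c. c \<in> A \<and> p \<in> fst c)"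

definition change_jac ::
  "('a, 'n::finite) chart \<Rightarrow> ('a, 'n) chart \<Rightarrow> 'a \<Rightarrow> real^'n^'n" where
  "change_jac c d p = jacobian (snd d \<circ> chart_inv c) (at (snd c p))"

definition cvec :: "real^'n \<Rightarrow> complex^'n" where
  "cvec v = (\<chi> i. complex_of_real (v $ i))"

definition cmat :: "real^'n^'n \<Rightarrow> complex^'n^'n" where
  "cmat J = map_matrix complex_of_real J"

text \<open>
  The bundles used here are associated to the frame bundle. Each is given by the action of a
  Jacobian matrix \<open>J\<close> on its typical fibre.
\<close>

definition act_TM :: "real^'n^'n \<Rightarrow> real^'n \<Rightarrow> real^'n::finite" where
  "act_TM J v = J *v v"

definition act_TCM :: "real^'n^'n \<Rightarrow> complex^'n \<Rightarrow> complex^'n::finite" where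
  "act_TCM J v = cmat J *v v"

definition act_CotCM :: "real^'n^'n \<Rightarrow> complex^'n \<Rightarrow> complex^'n::finite" where
  "act_CotCM J \<xi> = transpose (cmat (matrix_inv J)) *v \<xi>"

definition act_GTCM ::
  "real^'n^'n \<Rightarrow> (complex^'n) \<times> (complex^'n) \<Rightarrow> (complex^'n) \<times> (complex^'n::finite)" where
  "act_GTCM J v = (act_TCM J (fst v), act_CotCM J (snd v))"

definition act_biv :: "real^'n^'n \<Rightarrow> complex^'n^'n \<Rightarrow> complex^'n^'n::finite" where
  "act_biv J P = cmat J ** P ** transpose (cmat J)"

definition local_rep ::
  "('a, 'n::finite) chart set \<Rightarrow> (real^'n^'n \<Rightarrow> 'v \<Rightarrow> 'v) \<Rightarrow> ('a, 'n) chart \<Rightarrow> ('a \<Rightarrow> 'v) \<Rightarrow> real^'n \<Rightarrow> 'v"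
  where
  "local_rep A act c s x =
     (let q = chart_inv c x in act (change_jac (chart_at A q) c q) (s q))"

definition smooth_section ::
  "('a, 'n::finite) chart set \<Rightarrow> (real^'n^'n \<Rightarrow> 'v \<Rightarrow> 'v) \<Rightarrow> 'a set \<Rightarrow> ('a \<Rightarrow> 'v::real_normed_vector) \<Rightarrow> bool"
  where
  "smooth_section A act U s \<longleftrightarrow>
     (\<forall>c\<in>A. smooth_on (snd c ` (fst c \<inter> U)) (local_rep A act c s))"

text \<open>
  Smooth subbundles, by local frames; the scalar multiplication \<open>smul\<close> decides between real and
  complex subbundles. The rank is locally constant.
\<close>

definition smooth_subbundle ::
  "('a::topological_space, 'n::finite) chart set \<Rightarrow> (real^'n^'n \<Rightarrow> 'v \<Rightarrow> 'v) \<Rightarrow>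
   ('k::field \<Rightarrow> 'v \<Rightarrow> 'v::real_normed_vector) \<Rightarrow> ('a \<Rightarrow> 'v set) \<Rightarrow> bool" where
  "smooth_subbundle A act smul V \<longleftrightarrow>
     (\<forall>p. \<exists>U k (s :: nat \<Rightarrow> 'a \<Rightarrow> 'v). open U \<and> p \<in> U \<and>
        (\<forall>i<k. smooth_section A act U (s i)) \<and>
        (\<forall>q\<in>U. inj_on (\<lambda>i. s i q) {..<k} \<and>
               \<not> module.dependent smul ((\<lambda>i. s i q) ` {..<k}) \<and>
               module.span smul ((\<lambda>i. s i q) ` {..<k}) = V q))"

section \<open>Brackets\<close>

text \<open>
  Coordinate expressions of the complex bilinear brackets at a point \<open>x\<close> of \<open>\<real>\<^sup>n\<close>. Only real
  derivatives of complex-valued functions are involved. Since the expressions are invariant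
  under changes of coordinates, the value on \<open>M\<close> at \<open>p\<close> is computed in \<open>chart_at A p\<close>, the chart
  in which the fibres at \<open>p\<close> are expressed.
\<close>

definition pd :: "'n \<Rightarrow> (real^'n \<Rightarrow> complex) \<Rightarrow> real^'n::finite \<Rightarrow> complex" where
  "pd i f x = frechet_derivative f (at x) (axis i 1)"

definition lie_bracket ::
  "(real^'n \<Rightarrow> complex^'n) \<Rightarrow> (real^'n \<Rightarrow> complex^'n) \<Rightarrow> real^'n \<Rightarrow> complex^'n::finite" where
  "lie_bracket X Y x =
     (\<chi> k. \<Sum>i\<in>UNIV. X x $ i * pd i (\<lambda>y. Y y $ k) x - Y x $ i * pd i (\<lambda>y. X y $ k) x)"

definition lie_deriv_form ::
  "(real^'n \<Rightarrow> complex^'n) \<Rightarrow> (real^'n \<Rightarrow> complex^'n) \<Rightarrow> real^'n \<Rightarrow> complex^'n::finite" where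
  "lie_deriv_form X \<eta> x =
     (\<chi> k. \<Sum>i\<in>UNIV. X x $ i * pd i (\<lambda>y. \<eta> y $ k) x + \<eta> x $ i * pd k (\<lambda>y. X y $ i) x)"

text \<open>The matrix \<open>d\<xi>(\<partial>\<^sub>i, \<partial>\<^sub>j)\<close>, and the contraction \<open>\<iota>\<^sub>Y\<omega> = \<omega>(Y, -)\<close>.\<close>

definition ext_deriv_form :: "(real^'n \<Rightarrow> complex^'n) \<Rightarrow> real^'n \<Rightarrow> complex^'n^'n::finite" where
  "ext_deriv_form \<xi> x = (\<chi> i j. pd i (\<lambda>y. \<xi> y $ j) x - pd j (\<lambda>y. \<xi> y $ i) x)"

definition contract :: "complex^'n \<Rightarrow> complex^'n^'n \<Rightarrow> complex^'n::finite" where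
  "contract Y \<omega> = (\<chi> j. \<Sum>i\<in>UNIV. Y $ i * \<omega> $ i $ j)"

definition courant_coord ::
  "(real^'n \<Rightarrow> (complex^'n) \<times> (complex^'n)) \<Rightarrow> (real^'n \<Rightarrow> (complex^'n) \<times> (complex^'n)) \<Rightarrow>
   real^'n \<Rightarrow> (complex^'n) \<times> (complex^'n::finite)" where
  "courant_coord s t x =
     (let X = fst \<circ> s; \<xi> = snd \<circ> s; Y = fst \<circ> t; \<eta> = snd \<circ> t in
      (lie_bracket X Y x, lie_deriv_form X \<eta> x - contract (Y x) (ext_deriv_form \<xi> x)))"

definition courant ::
  "('a, 'n::finite) chart set \<Rightarrow> ('a \<Rightarrow> (complex^'n) \<times> (complex^'n)) \<Rightarrow>
   ('a \<Rightarrow> (complex^'n) \<times> (complex^'n)) \<Rightarrow> 'a \<Rightarrow> (complex^'n) \<times> (complex^'n)" where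
  "courant A s t p =
     (let c = chart_at A p in
      courant_coord (local_rep A act_GTCM c s) (local_rep A act_GTCM c t) (snd c p))"

text \<open>
  The components \<open>[P, Q]\<^sup>i\<^sup>j\<^sup>k\<close> of the Schouten bracket of two bivector fields; the sum is over
  \<open>l\<close> and the cyclic permutations of \<open>i, j, k\<close>. This is the bracket with
  \<open>[X \<and> Y, Z \<and> W] = [X,Z] \<and> Y \<and> W - [X,W] \<and> Y \<and> Z - [Y,Z] \<and> X \<and> W + [Y,W] \<and> X \<and> Z\<close>.
\<close>

definition schouten_coord ::
  "(real^'n \<Rightarrow> complex^'n^'n) \<Rightarrow> (real^'n \<Rightarrow> complex^'n^'n) \<Rightarrow> real^'n \<Rightarrow> 'n \<Rightarrow> 'n \<Rightarrow> 'n::finite \<Rightarrow> complex"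
  where
  "schouten_coord P Q x i j k =
     (let T = (\<lambda>P Q i j k. \<Sum>l\<in>UNIV. P x $ i $ l * pd l (\<lambda>y. Q y $ j $ k) x) in
      T P Q i j k + T P Q j k i + T P Q k i j + T Q P i j k + T Q P j k i + T Q P k i j)"

definition schouten ::
  "('a, 'n::finite) chart set \<Rightarrow> ('a \<Rightarrow> complex^'n^'n) \<Rightarrow> ('a \<Rightarrow> complex^'n^'n) \<Rightarrow>
   'a \<Rightarrow> 'n \<Rightarrow> 'n \<Rightarrow> 'n \<Rightarrow> complex" where
  "schouten A P Q p =
     (let c = chart_at A p in
      schouten_coord (local_rep A act_biv c P) (local_rep A act_biv c Q) (snd c p))"

definition complex_poisson :: "('a, 'n::finite) chart set \<Rightarrow> ('a \<Rightarrow> complex^'n^'n) \<Rightarrow> bool" where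
  "complex_poisson A \<pi> \<longleftrightarrow>
     (\<forall>p. transpose (\<pi> p) = - \<pi> p) \<and> smooth_section A act_biv UNIV \<pi> \<and>
     (\<forall>p i j k. schouten A \<pi> \<pi> p i j k = 0)"

section \<open>Lagrangian families and Dirac structures\<close>

definition cscale ::
  "complex \<Rightarrow> (complex^'n) \<times> (complex^'n) \<Rightarrow> (complex^'n) \<times> (complex^'n::finite)" where
  "cscale z v = (z *s fst v, z *s snd v)"

definition pairing :: "(complex^'n) \<times> (complex^'n) \<Rightarrow> (complex^'n) \<times> (complex^'n::finite) \<Rightarrow> complex" where
  "pairing v w = (1/2) * (scalar_product (snd w) (fst v) + scalar_product (snd v) (fst w))"

definition lagrangian :: "((complex^'n) \<times> (complex^'n::finite)) set \<Rightarrow> bool" where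
  "lagrangian L \<longleftrightarrow> module.subspace cscale L \<and> L = {v. \<forall>w\<in>L. pairing v w = 0}"

text \<open>Involutivity is stated for local sections, i.e. for the sheaf of sections of \<open>L\<close>.\<close>

definition involutive ::
  "('a::topological_space, 'n::finite) chart set \<Rightarrow> ('a \<Rightarrow> ((complex^'n) \<times> (complex^'n)) set) \<Rightarrow> bool" where
  "involutive A L \<longleftrightarrow>
     (\<forall>U s t. open U \<and> smooth_section A act_GTCM U s \<and> smooth_section A act_GTCM U t \<and>
        (\<forall>p\<in>U. s p \<in> L p \<and> t p \<in> L p) \<longrightarrow> (\<forall>p\<in>U. courant A s t p \<in> L p))"

definition complex_dirac ::
  "('a::topological_space, 'n::finite) chart set \<Rightarrow> ('a \<Rightarrow> ((complex^'n) \<times> (complex^'n)) set) \<Rightarrow> bool" where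
  "complex_dirac A L \<longleftrightarrow>
     (\<forall>p. lagrangian (L p)) \<and> smooth_subbundle A act_GTCM cscale L \<and> involutive A L"

text \<open>The following operations are fibrewise: each acts on the subspaces at a single point.\<close>

definition check_fam :: "((complex^'n) \<times> (complex^'n)) set \<Rightarrow> ((real^'n) \<times> (real^'n::finite)) set" where
  "check_fam L = {(X, \<xi>). \<exists>\<eta>. (cvec X, cvec \<xi> + \<i> *s cvec \<eta>) \<in> L}"

definition hat_fam :: "((complex^'n) \<times> (complex^'n)) set \<Rightarrow> ((real^'n) \<times> (real^'n::finite)) set" where
  "hat_fam L = {(X, \<xi>). \<exists>\<eta>. (cvec X, cvec \<eta> + \<i> *s cvec \<xi>) \<in> L}"

definition tangent_sum :: "((complex^'n) \<times> (complex^'n)) set \<Rightarrow> ((complex^'n) \<times> (complex^'n)) set \<Rightarrow>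
    ((complex^'n) \<times> (complex^'n::finite)) set" where
  "tangent_sum L1 L2 = {(X, \<eta>1 + \<eta>2) |X \<eta>1 \<eta>2. (X, \<eta>1) \<in> L1 \<and> (X, \<eta>2) \<in> L2}"

definition rescale ::
  "complex \<Rightarrow> ((complex^'n) \<times> (complex^'n)) set \<Rightarrow> ((complex^'n) \<times> (complex^'n::finite)) set" where
  "rescale z L = {(X, z *s \<xi>) |X \<xi>. (X, \<xi>) \<in> L}"

definition complexify :: "(real^'n) set \<Rightarrow> (complex^'n::finite) set" where
  "complexify D = {cvec u + \<i> *s cvec v |u v. u \<in> D \<and> v \<in> D}"

definition complexify_fam ::
  "((real^'n) \<times> (real^'n)) set \<Rightarrow> ((complex^'n) \<times> (complex^'n::finite)) set" where
  "complexify_fam L =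
     {(cvec X + \<i> *s cvec Y, cvec \<xi> + \<i> *s cvec \<eta>) |X \<xi> Y \<eta>. (X, \<xi>) \<in> L \<and> (Y, \<eta>) \<in> L}"

definition complex_tangent_sum :: "((real^'n) \<times> (real^'n)) set \<Rightarrow> ((real^'n) \<times> (real^'n)) set \<Rightarrow>
    ((complex^'n) \<times> (complex^'n::finite)) set" where
  "complex_tangent_sum L1 L2 = tangent_sum (complexify_fam L1) (rescale \<i> (complexify_fam L2))"

definition quasi_real ::
  "('a \<Rightarrow> ((complex^'n) \<times> (complex^'n)) set) \<Rightarrow> 'a \<Rightarrow> ((complex^'n) \<times> (complex^'n::finite)) set" where
  "quasi_real L p = complex_tangent_sum (check_fam (L p)) (hat_fam (L p))"

definition form_graph :: "(complex^'n) set \<Rightarrow> (complex^'n \<Rightarrow> complex^'n \<Rightarrow> complex) \<Rightarrow>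
    ((complex^'n) \<times> (complex^'n::finite)) set" where
  "form_graph E \<epsilon> = {(X, \<xi>). X \<in> E \<and> (\<forall>Y\<in>E. scalar_product \<xi> Y = \<epsilon> X Y)}"

section \<open>Data attached to a complex bivector field\<close>

definition biv_eval :: "complex^'n^'n \<Rightarrow> complex^'n \<Rightarrow> complex^'n \<Rightarrow> complex" where
  "biv_eval P \<alpha> \<beta> = (\<Sum>i\<in>UNIV. \<Sum>j\<in>UNIV. \<alpha> $ i * P $ i $ j * \<beta> $ j)"

definition sharp :: "complex^'n^'n \<Rightarrow> complex^'n \<Rightarrow> complex^'n::finite" where
  "sharp P \<beta> = P *v \<beta>"

lemma scalar_product_sharp: "scalar_product \<alpha> (sharp P \<beta>) = biv_eval P \<alpha> \<beta>"
  by (simp add: scalar_product_def sharp_def biv_eval_def matrix_vector_mult_def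
      sum_distrib_left mult.assoc)

definition biv_graph :: "('a \<Rightarrow> complex^'n^'n) \<Rightarrow> 'a \<Rightarrow> ((complex^'n) \<times> (complex^'n::finite)) set" where
  "biv_graph \<pi> p = {(sharp (\<pi> p) \<alpha>, \<alpha>) |\<alpha>. True}"

definition E_dist :: "('a \<Rightarrow> complex^'n^'n) \<Rightarrow> 'a \<Rightarrow> (complex^'n::finite) set" where
  "E_dist \<pi> p = range (sharp (\<pi> p))"

definition Delta_dist :: "('a \<Rightarrow> complex^'n^'n) \<Rightarrow> 'a \<Rightarrow> (real^'n::finite) set" where
  "Delta_dist \<pi> p = {v. cvec v \<in> E_dist \<pi> p}"

text \<open>The form \<open>\<Omega>\<close>; its value is meaningful only on \<open>E_dist \<pi> p\<close>, see the lemma after it.\<close>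

definition Omega_form :: "('a \<Rightarrow> complex^'n^'n) \<Rightarrow> 'a \<Rightarrow> complex^'n \<Rightarrow> complex^'n::finite \<Rightarrow> complex" where
  "Omega_form \<pi> p X Y =
     (THE z. \<exists>\<alpha> \<beta>. X = sharp (\<pi> p) \<alpha> \<and> Y = sharp (\<pi> p) \<beta> \<and> z = biv_eval (\<pi> p) \<alpha> \<beta>)"

lemma biv_eval_skew:
  assumes "transpose P = - P"
  shows "biv_eval P \<beta> \<alpha> = - biv_eval P \<alpha> \<beta>"
proof -
  have s: "P $ i $ j = - P $ j $ i" for i j
  proof -
    have "P $ i $ j = transpose P $ j $ i" by (simp add: transpose_def)
    also have "\<dots> = - P $ j $ i" unfolding assms by simp
    finally show ?thesis .
  qed
  have "biv_eval P \<beta> \<alpha> = (\<Sum>i\<in>UNIV. \<Sum>j\<in>UNIV. \<beta> $ j * P $ j $ i * \<alpha> $ i)"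
    unfolding biv_eval_def by (rule sum.swap)
  also have "\<dots> = (\<Sum>i\<in>UNIV. \<Sum>j\<in>UNIV. - (\<alpha> $ i * P $ i $ j * \<beta> $ j))"
    by (intro sum.cong refl) (subst s, simp add: mult_ac)
  finally show ?thesis by (simp add: biv_eval_def sum_negf)
qed

lemma Omega_form_sharp:
  assumes "transpose (\<pi> p) = - \<pi> p"
  shows "Omega_form \<pi> p (sharp (\<pi> p) \<alpha>) (sharp (\<pi> p) \<beta>) = biv_eval (\<pi> p) \<alpha> \<beta>"
  unfolding Omega_form_def
proof (rule the_equality)
  fix z
  assume "\<exists>\<alpha>' \<beta>'. sharp (\<pi> p) \<alpha> = sharp (\<pi> p) \<alpha>' \<and> sharp (\<pi> p) \<beta> = sharp (\<pi> p) \<beta>' \<and>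
            z = biv_eval (\<pi> p) \<alpha>' \<beta>'"
  then obtain \<alpha>' \<beta>' where eq: "sharp (\<pi> p) \<alpha> = sharp (\<pi> p) \<alpha>'" "sharp (\<pi> p) \<beta> = sharp (\<pi> p) \<beta>'"
    and z: "z = biv_eval (\<pi> p) \<alpha>' \<beta>'" by blast
  have "z = biv_eval (\<pi> p) \<alpha>' \<beta>"
    unfolding z scalar_product_sharp[symmetric] eq(2) ..
  also have "\<dots> = - biv_eval (\<pi> p) \<beta> \<alpha>'" by (rule biv_eval_skew[OF assms])
  also have "biv_eval (\<pi> p) \<beta> \<alpha>' = biv_eval (\<pi> p) \<beta> \<alpha>"
    unfolding scalar_product_sharp[symmetric] eq(1) ..
  also have "- biv_eval (\<pi> p) \<beta> \<alpha> = biv_eval (\<pi> p) \<alpha> \<beta>"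
    by (rule biv_eval_skew[OF assms, symmetric])
  finally show "z = biv_eval (\<pi> p) \<alpha> \<beta>" .
qed blast

definition strongly_regular ::
  "('a::topological_space, 'n::finite) chart set \<Rightarrow> ('a \<Rightarrow> complex^'n^'n) \<Rightarrow> bool" where
  "strongly_regular A \<pi> \<longleftrightarrow>
     smooth_subbundle A act_TCM (*s) (E_dist \<pi>) \<and>
     smooth_subbundle A act_TM (*\<^sub>R) (Delta_dist \<pi>)"

end

theory Submission
  imports Defs
begin

text \<open>
  Pointwise, \<open>\<Delta>\<^sub>\<complex> = E \<inter> cnj E\<close>, and the real parts of the annihilator of \<open>E\<close> are exactly the
  annihilator of \<open>\<Delta>\<close>. Hence the real and imaginary parts of lifts of \<open>\<Delta>\<close> through \<open>\<pi>\<^sup>\<sharp>\<close> give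
  the whole of \<open>L(\<Delta>\<^sub>\<complex>, \<Omega>)\<close>, whose elements are the \<open>X + \<xi>\<close> with \<open>X = \<pi>\<^sup>\<sharp>\<alpha> \<in> \<Delta>\<^sub>\<complex>\<close> and \<open>\<xi> - \<alpha>\<close>
  vanishing on \<open>\<Delta>\<^sub>\<complex>\<close>.

  If \<open>E\<close> and \<open>\<Delta>\<close> have locally constant rank, sections of \<open>E\<close> have smooth lifts, and the fibres
  \<open>L(\<Delta>\<^sub>\<complex>, \<Omega>)\<close> near a point are carried into each other by smooth invertible linear maps, which
  gives local frames. By the Poisson condition the bracket of \<open>\<pi>\<^sup>\<sharp>\<alpha> + \<alpha>\<close> and \<open>\<pi>\<^sup>\<sharp>\<beta> + \<beta>\<close> is again in the
  graph of \<open>\<pi>\<close>. In particular sections of \<open>E\<close>, and by conjugation those of \<open>\<Delta>\<^sub>\<complex>\<close>, are closed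
  under the Lie bracket. The form part of a bracket, restricted to \<open>\<Delta>\<^sub>\<complex>\<close>, then only depends on the
  restrictions of the forms to \<open>\<Delta>\<^sub>\<complex>\<close>, so that \<open>\<xi>\<close> may be replaced by \<open>\<alpha>\<close>.
\<close>

section \<open>Linear algebra of the quasi-real family at a point\<close>

lemma scalar_product_simps [simp]:
  fixes u v w :: "'a::comm_ring_1^'n"
  shows "scalar_product (u + v) w = scalar_product u w + scalar_product v w"
    and "scalar_product u (v + w) = scalar_product u v + scalar_product u w"
    and "scalar_product (u - v) w = scalar_product u w - scalar_product v w"
    and "scalar_product u (v - w) = scalar_product u v - scalar_product u w"
    and "scalar_product (c *s u) w = c * scalar_product u w"
    and "scalar_product u (c *s w) = c * scalar_product u w"
    and "scalar_product (- u) w = - scalar_product u w"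
    and "scalar_product u (- w) = - scalar_product u w"
    and "scalar_product 0 w = 0"
    and "scalar_product u 0 = 0"
  by (simp_all add: scalar_product_def sum.distrib sum_subtractf sum_distrib_left sum_negf
      algebra_simps)

lemma scalar_product_commute: "scalar_product u v = scalar_product v (u :: 'a::comm_ring_1^'n)"
  by (simp add: scalar_product_def mult.commute)

lemma scalar_product_matrix:
  fixes K :: "'a::comm_ring_1^'n^'m"
  shows "scalar_product u (K *v v) = scalar_product (transpose K *v u) v"
  unfolding scalar_product_def matrix_vector_mult_def transpose_def
  by (simp add: sum_distrib_left sum_distrib_right mult_ac) (rule sum.swap)

text \<open>A basis of \<open>V\<close> stays independent after adding \<open>v\<close>, so some
  linear map kills \<open>V\<close> and sends \<open>v\<close> to the all-ones vector. Every row of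
  its matrix is then a separating functional.\<close>

lemma annihilator_separation:
  fixes V :: "('a::field^'n::finite) set"
  assumes V: "vec.subspace V" and v: "v \<notin> V"
  obtains \<gamma> where "\<And>w. w \<in> V \<Longrightarrow> scalar_product \<gamma> w = 0" "scalar_product \<gamma> v \<noteq> 0"
proof -
  obtain B where B: "B \<subseteq> V" "vec.independent B" "V \<subseteq> vec.span B"
    using vec.maximal_independent_subset[of V] by metis
  have sp: "vec.span B = V"
    using B V by (meson order_antisym vec.span_minimal)
  have ind: "vec.independent (insert v B)"
    using v B(2) by (simp add: vec.independent_insert sp)
  obtain f :: "'a^'n \<Rightarrow> 'a^'n" where f: "Vector_Spaces.linear (*s) (*s) f"
    and fB: "\<And>x. x \<in> insert v B \<Longrightarrow> f x = (if x = v then (\<chi> _. 1) else 0)"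
    using vec.linear_independent_extend[OF ind, of "\<lambda>x. if x = v then (\<chi> _. 1) else 0"] by blast
  \<comment> \<open>\<open>undefined\<close> is merely some row index; any row works, since all
    entries of \<open>f v\<close> are 1.\<close>
  define \<gamma> where "\<gamma> = matrix f $ undefined"
  have \<gamma>: "scalar_product \<gamma> w = f w $ undefined" for w
    by (simp add: \<gamma>_def matrix_works[OF f, symmetric] scalar_product_def matrix_vector_mult_def)
  interpret f: Vector_Spaces.linear "(*s)" "(*s)" f by (rule f)
  have "f w = 0" if "w \<in> V" for w
  proof -
    have "w \<in> vec.span B" using that sp by simp
    then show ?thesis
    proof (rule vec.span_induct)
      show "vec.subspace {w. f w = 0}" by (rule f.subspace_kernel)
      show "f x = 0" if "x \<in> B" for x using fB[of x] that v B(1) by auto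
    qed
  qed
  then show ?thesis using that[of \<gamma>] fB[of v] by (simp add: \<gamma>)
qed

section \<open>Real structure of complex vectors, and the complexified real distribution\<close>

definition vcnj :: "complex^'n \<Rightarrow> complex^'n" where "vcnj v = (\<chi> i. cnj (v $ i))"
definition vRe :: "complex^'n \<Rightarrow> real^'n" where "vRe v = (\<chi> i. Re (v $ i))"
definition vIm :: "complex^'n \<Rightarrow> real^'n" where "vIm v = (\<chi> i. Im (v $ i))"

lemma vcnj_nth [simp]: "vcnj v $ i = cnj (v $ i)" by (simp add: vcnj_def)
lemma vRe_nth [simp]: "vRe v $ i = Re (v $ i)" by (simp add: vRe_def)
lemma vIm_nth [simp]: "vIm v $ i = Im (v $ i)" by (simp add: vIm_def)
lemma cvec_nth [simp]: "cvec v $ i = complex_of_real (v $ i)" by (simp add: cvec_def)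

lemma cvec_vRe_vIm: "cvec (vRe v) + \<i> *s cvec (vIm v) = v"
  by (simp add: vec_eq_iff complex_eq_iff)

lemma vRe_cvec [simp]: "vRe (cvec u + \<i> *s cvec v) = u" and vIm_cvec [simp]: "vIm (cvec u + \<i> *s cvec v) = v"
  by (simp_all add: vec_eq_iff)

lemma cvec_vRe: "cvec (vRe v) = (1/2) *s (v + vcnj v)"
  and cvec_vIm: "cvec (vIm v) = (- \<i>/2) *s (v - vcnj v)"
  by (simp_all add: vec_eq_iff complex_eq_iff)

lemma vcnj_cvec [simp]: "vcnj (cvec u) = cvec u"
  and vcnj_add [simp]: "vcnj (v + w) = vcnj v + vcnj w"
  and vcnj_scale [simp]: "vcnj (c *s v) = cnj c *s vcnj v"
  and vcnj_0 [simp]: "vcnj 0 = 0"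
  and vcnj_vcnj [simp]: "vcnj (vcnj v) = v"
  by (simp_all add: vec_eq_iff)

lemma cvec_simps [simp]:
  "cvec (u + v) = cvec u + cvec v" "cvec (u - v) = cvec u - cvec v" "cvec 0 = 0"
  "cvec (r *\<^sub>R u) = complex_of_real r *s cvec u"
  by (simp_all add: vec_eq_iff)

lemma scalar_product_cvec: "scalar_product (cvec u) (cvec v) = complex_of_real (scalar_product u v)"
  by (simp add: scalar_product_def)

text \<open>E \<inter> cnj E for the range E of \<open>P\<close>: the form in which the complexified
  \<Delta> is handled below, see \<open>complexify_Delta\<close>. Stability under conjugation is
  built in.\<close>

definition real_core :: "complex^'n^'n \<Rightarrow> (complex^'n::finite) set" where
  "real_core P = {Z \<in> range ((*v) P). vcnj Z \<in> range ((*v) P)}"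

text \<open>This is the graph of \<Omega> over the complexified \<Delta>, written without \<Omega>:
  contracting \<Omega> with X gives the restriction of any lift \<alpha> of X, so the forms over X
  are the sums of a lift and an annihilator of the core.\<close>

definition qr_graph :: "complex^'n^'n \<Rightarrow> ((complex^'n) \<times> (complex^'n::finite)) set" where
  "qr_graph P = {(P *v \<alpha>, \<alpha> + \<theta>) |\<alpha> \<theta>. P *v \<alpha> \<in> real_core P \<and> (\<forall>Z\<in>real_core P. scalar_product \<theta> Z = 0)}"

lemma qr_graphI:
  "X = P *v \<alpha> \<Longrightarrow> X \<in> real_core P \<Longrightarrow> (\<And>Z. Z \<in> real_core P \<Longrightarrow> scalar_product (\<xi> - \<alpha>) Z = 0) \<Longrightarrow> (X, \<xi>) \<in> qr_graph P"
  unfolding qr_graph_def by (smt (verit, ccfv_threshold) add.commute diff_add_cancel mem_Collect_eq)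

lemma qr_graphE:
  assumes "(X, \<xi>) \<in> qr_graph P"
  obtains \<alpha> where "X = P *v \<alpha>" "X \<in> real_core P" "\<And>Z. Z \<in> real_core P \<Longrightarrow> scalar_product (\<xi> - \<alpha>) Z = 0"
  using assms unfolding qr_graph_def by auto

lemma subspace_range: "vec.subspace (range ((*v) (P :: 'a::field^'n^'m)))"
  by (rule vec.subspace_image[OF vec.subspace_UNIV])

lemma subspace_core: "vec.subspace (real_core P)"
  using subspace_range[of P] unfolding vec.subspace_def real_core_def
  by (auto simp del: vcnj_0) (metis matrix_vector_mult_0_right rangeI vcnj_0)

lemma core_vcnj: "Z \<in> real_core P \<Longrightarrow> vcnj Z \<in> real_core P" by (simp add: real_core_def)

lemma cvec_in_core: "cvec v \<in> real_core P \<longleftrightarrow> cvec v \<in> range ((*v) P)"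
  by (simp add: real_core_def)

lemma core_parts:
  assumes "Z \<in> real_core P" shows "cvec (vRe Z) \<in> real_core P" "cvec (vIm Z) \<in> real_core P"
  unfolding cvec_vRe cvec_vIm using core_vcnj[OF assms] assms subspace_core[of P]
  by (auto intro!: vec.subspace_scale vec.subspace_add vec.subspace_diff)

lemma core_parts_iff: "Z \<in> real_core P \<longleftrightarrow> cvec (vRe Z) \<in> real_core P \<and> cvec (vIm Z) \<in> real_core P"
  using core_parts subspace_core[of P]
  by (metis cvec_vRe_vIm vec.subspace_add vec.subspace_scale)

text \<open>The core is the complex span of its real vectors, so testing on real vectors suffices.
  This connects annihilators of the core with those of \<Delta>.\<close>

lemma annihilates_core_iff:
  "(\<forall>Z\<in>real_core P. scalar_product \<theta> Z = 0) \<longleftrightarrow>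
   (\<forall>v. cvec v \<in> range ((*v) P) \<longrightarrow> scalar_product \<theta> (cvec v) = 0)"
proof (intro iffI allI ballI impI)
  fix Z assume *: "\<forall>v. cvec v \<in> range ((*v) P) \<longrightarrow> scalar_product \<theta> (cvec v) = 0" and "Z \<in> real_core P"
  then have "scalar_product \<theta> (cvec (vRe Z) + \<i> *s cvec (vIm Z)) = 0"
    using core_parts[of Z P] cvec_in_core[of _ P] by simp
  then show "scalar_product \<theta> Z = 0" by (simp only: cvec_vRe_vIm)
qed (simp add: cvec_in_core[symmetric])

lemma sharp_eq: "sharp P = (*v) P" by (rule ext) (simp add: sharp_def)

lemma Delta_dist_iff: "v \<in> Delta_dist \<pi> p \<longleftrightarrow> cvec v \<in> range ((*v) (\<pi> p))"
  by (simp add: Delta_dist_def E_dist_def sharp_eq)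

lemma complexify_Delta: "complexify (Delta_dist \<pi> p) = real_core (\<pi> p)"
proof (intro equalityI subsetI)
  fix X assume "X \<in> complexify (Delta_dist \<pi> p)"
  then show "X \<in> real_core (\<pi> p)"
    by (auto simp: complexify_def Delta_dist_iff cvec_in_core[symmetric] core_parts_iff[of "_ + _"])
next
  fix X assume "X \<in> real_core (\<pi> p)"
  then show "X \<in> complexify (Delta_dist \<pi> p)"
    unfolding complexify_def using core_parts[of X "\<pi> p"] cvec_vRe_vIm[of X]
    by (force simp: Delta_dist_iff cvec_in_core[symmetric])
qed

section \<open>Skew matrices: kernels, annihilators and their real parts\<close>

lemma skew_scalar_product:
  assumes "transpose P = - (P :: complex^'n::finite^'n)"
  shows "scalar_product \<alpha> (P *v \<beta>) = - scalar_product \<beta> (P *v \<alpha>)"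
  using biv_eval_skew[OF assms, of \<alpha> \<beta>]
  by (simp add: scalar_product_sharp[symmetric] sharp_eq)

text \<open>By skewness, \<beta> paired with \<open>P *v \<alpha>\<close> is up to sign \<alpha>
  paired with \<open>P *v \<beta>\<close>. This makes the choice of lifts harmless: two lifts of one
  vector differ by a form that vanishes on the range, hence on the core.\<close>

lemma skew_kernel:
  assumes "transpose P = - (P :: complex^'n::finite^'n)"
  shows "P *v \<alpha> = 0 \<longleftrightarrow> (\<forall>Z\<in>range ((*v) P). scalar_product \<alpha> Z = 0)"
proof
  assume *: "\<forall>Z\<in>range ((*v) P). scalar_product \<alpha> Z = 0"
  have "scalar_product \<beta> (P *v \<alpha>) = 0" for \<beta>
    using * skew_scalar_product[OF assms, of \<beta> \<alpha>] by simp
  from this[of "axis _ 1"] show "P *v \<alpha> = 0"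
    by (simp add: scalar_product_def axis_def vec_eq_iff if_distrib if_distribR cong: if_cong)
qed (auto simp: skew_scalar_product[OF assms])

text \<open>The real parts of the annihilator of \<open>E\<close> fill up the annihilator of \<open>E \<inter> TM\<close>, because a
  real vector killed by all of them is killed by the whole annihilator of \<open>E\<close>.\<close>

lemma real_annihilator_lift:
  fixes E :: "(complex^'n::finite) set"
  assumes E: "vec.subspace E"
    and u: "\<And>v. cvec v \<in> E \<Longrightarrow> scalar_product u v = 0"
  obtains u' where "\<And>Z. Z \<in> E \<Longrightarrow> scalar_product (cvec u + \<i> *s cvec u') Z = 0"
proof -
  define A where "A = {\<alpha>. \<forall>Z\<in>E. scalar_product \<alpha> Z = 0}"
  have iA: "c *s \<alpha> \<in> A" if "\<alpha> \<in> A" for c \<alpha> using that by (simp add: A_def)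
  have aA: "\<alpha> + \<beta> \<in> A" if "\<alpha> \<in> A" "\<beta> \<in> A" for \<alpha> \<beta> using that by (simp add: A_def)
  have sub: "vec.subspace (vRe ` A)"
    unfolding vec.subspace_def
  proof (intro conjI ballI allI)
    show "0 \<in> vRe ` A" by (rule image_eqI[of _ _ 0]) (simp_all add: A_def vec_eq_iff)
  next
    fix x y assume "x \<in> vRe ` A" "y \<in> vRe ` A"
    then obtain a b where "a \<in> A" "b \<in> A" "x = vRe a" "y = vRe b" by blast
    then show "x + y \<in> vRe ` A" by (intro image_eqI[of _ _ "a + b"] aA) (simp_all add: vec_eq_iff)
  next
    fix c x assume "x \<in> vRe ` A"
    then obtain a where "a \<in> A" "x = vRe a" by blast
    then show "c *s x \<in> vRe ` A"
      by (intro image_eqI[of _ _ "complex_of_real c *s a"] iA) (simp_all add: vec_eq_iff)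
  qed
  have "u \<in> vRe ` A"
  proof (rule ccontr)
    assume "u \<notin> vRe ` A"
    from annihilator_separation[OF sub this] obtain v where
      v: "\<And>w. w \<in> vRe ` A \<Longrightarrow> scalar_product v w = 0" "scalar_product v u \<noteq> 0" by blast
    have *: "Re (scalar_product \<alpha> (cvec v)) = 0" if "\<alpha> \<in> A" for \<alpha>
      using v(1)[of "vRe \<alpha>"] that by (simp add: scalar_product_def mult.commute)
    \<comment> \<open>\<open>A\<close> is closed under multiplication by \<open>\<i>\<close>, so the
      real part may be tested on \<alpha> and on \<open>\<i> *s \<alpha>\<close>.\<close>
    have **: "scalar_product \<alpha> (cvec v) = 0" if "\<alpha> \<in> A" for \<alpha>
      using *[OF that] *[OF iA[OF that], of \<i>] by (simp add: complex_eq_iff)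
    have "cvec v \<in> E"
    proof (rule ccontr)
      assume "cvec v \<notin> E"
      from annihilator_separation[OF E this] obtain \<gamma> where
        "\<And>w. w \<in> E \<Longrightarrow> scalar_product \<gamma> w = 0" "scalar_product \<gamma> (cvec v) \<noteq> 0" by blast
      then show False using **[of \<gamma>] by (simp add: A_def)
    qed
    then show False using u v(2) by (metis scalar_product_commute)
  qed
  then obtain \<alpha> where "\<alpha> \<in> A" "u = vRe \<alpha>" by blast
  then show ?thesis using that[of "vIm \<alpha>"] by (simp add: cvec_vRe_vIm A_def)
qed

section \<open>The two descriptions of the quasi-real family at a point, and its Lagrangian
  property\<close>

text \<open>Since \<Omega>(P \<alpha>, Y) = \<alpha>(Y) for Y in the core, the graph condition on
  \<xi> over X = P \<alpha> says that \<xi> - \<alpha> annihilates the core.\<close>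

lemma form_graph_eq_qr_graph:
  assumes skew: "transpose (\<pi> p) = - \<pi> p"
  shows "form_graph (complexify (Delta_dist \<pi> p)) (Omega_form \<pi> p) = qr_graph (\<pi> p)"
proof -
  have \<Omega>: "Omega_form \<pi> p (\<pi> p *v \<alpha>) Y = scalar_product \<alpha> Y" if Y: "Y \<in> real_core (\<pi> p)" for \<alpha> Y
  proof -
    obtain \<beta> where "Y = \<pi> p *v \<beta>" using Y by (auto simp: real_core_def)
    then show ?thesis
      using Omega_form_sharp[where \<pi> = \<pi> and p = p, OF skew, of \<alpha> \<beta>] by (simp add: sharp_eq scalar_product_sharp[symmetric])
  qed
  show ?thesis
  proof (intro equalityI subsetI)
    fix v assume "v \<in> form_graph (complexify (Delta_dist \<pi> p)) (Omega_form \<pi> p)"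
    then obtain X \<xi> where v: "v = (X, \<xi>)" and X: "X \<in> real_core (\<pi> p)"
      and \<xi>: "\<And>Y. Y \<in> real_core (\<pi> p) \<Longrightarrow> scalar_product \<xi> Y = Omega_form \<pi> p X Y"
      by (auto simp: form_graph_def complexify_Delta)
    obtain \<alpha> where \<alpha>: "X = \<pi> p *v \<alpha>" using X by (auto simp: real_core_def)
    show "v \<in> qr_graph (\<pi> p)" unfolding v
      by (rule qr_graphI[OF \<alpha> X]) (simp add: \<xi> \<Omega> \<alpha>)
  next
    fix v assume v: "v \<in> qr_graph (\<pi> p)"
    obtain X \<xi> where vv: "v = (X, \<xi>)" by fastforce
    obtain \<alpha> where "X = \<pi> p *v \<alpha>" "X \<in> real_core (\<pi> p)"
      "\<And>Z. Z \<in> real_core (\<pi> p) \<Longrightarrow> scalar_product (\<xi> - \<alpha>) Z = 0"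
      using qr_graphE[OF v[unfolded vv]] by metis
    then show "v \<in> form_graph (complexify (Delta_dist \<pi> p)) (Omega_form \<pi> p)"
      by (simp add: form_graph_def vv complexify_Delta \<Omega>)
  qed
qed

text \<open>Over a real vector X, \<open>check_fam\<close> of the graph collects the real parts and
  \<open>hat_fam\<close> the imaginary parts of lifts of X, where the two lifts may differ. One
  inclusion holds because the imaginary parts of two lifts agree on \<Delta>; the other because
  \<open>real_annihilator_lift\<close> allows the real part of a lift to be shifted by any real form
  that vanishes on \<Delta>.\<close>

lemma quasi_real_eq_qr_graph:
  assumes skew: "transpose (\<pi> p) = - \<pi> p"
  shows "quasi_real (biv_graph \<pi>) p = qr_graph (\<pi> p)"
proof -
  define P where "P = \<pi> p"
  have skew: "transpose P = - P" using skew by (simp add: P_def)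
  have graph: "(X, \<alpha>) \<in> biv_graph \<pi> p \<longleftrightarrow> X = P *v \<alpha>" for X \<alpha>
    by (auto simp: biv_graph_def sharp_eq P_def)
  have check: "(X, \<xi>) \<in> check_fam (biv_graph \<pi> p) \<longleftrightarrow> (\<exists>\<eta>. cvec X = P *v (cvec \<xi> + \<i> *s cvec \<eta>))"
    and hat: "(X, \<xi>) \<in> hat_fam (biv_graph \<pi> p) \<longleftrightarrow> (\<exists>\<eta>. cvec X = P *v (cvec \<eta> + \<i> *s cvec \<xi>))"
    for X \<xi> by (simp_all add: check_fam_def hat_fam_def graph)
  \<comment> \<open>The difference of two lifts annihilates E; on a real vector of E, the imaginary
    part of this equation compares \<open>a\<close> with \<open>h\<close>.\<close>
  have im: "scalar_product (cvec a) (cvec v) = scalar_product (cvec h) (cvec v)"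
    if "P *v (cvec x + \<i> *s cvec a) = P *v (cvec b + \<i> *s cvec h)" "cvec v \<in> range ((*v) P)" for x a b h v
  proof -
    have "P *v (cvec (x - b) + \<i> *s cvec (a - h)) = 0"
      using that(1) by (simp add: vec.add vec.diff vec.scale algebra_simps)
    then have "scalar_product (cvec (x - b) + \<i> *s cvec (a - h)) (cvec v) = 0"
      using skew_kernel[OF skew] that(2) by blast
    then have "complex_of_real (scalar_product (x - b) v) + \<i> * complex_of_real (scalar_product (a - h) v) = 0"
      by (simp only: scalar_product_simps scalar_product_cvec)
    then have "scalar_product (a - h) v = 0" by (simp add: complex_eq_iff)
    then show ?thesis by (simp add: scalar_product_cvec)
  qed
  have "quasi_real (biv_graph \<pi>) p = qr_graph P"
  proof (intro equalityI subsetI)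
    fix V assume "V \<in> quasi_real (biv_graph \<pi>) p"
    then obtain X1 X2 x1 x2 Y1 Y2 h1 h2 where
      V: "V = (cvec X1 + \<i> *s cvec X2, (cvec x1 + \<i> *s cvec x2) + \<i> *s (cvec h1 + \<i> *s cvec h2))"
      and c: "(X1, x1) \<in> check_fam (biv_graph \<pi> p)" "(X2, x2) \<in> check_fam (biv_graph \<pi> p)"
      and h: "(Y1, h1) \<in> hat_fam (biv_graph \<pi> p)" "(Y2, h2) \<in> hat_fam (biv_graph \<pi> p)"
      and eq: "cvec X1 + \<i> *s cvec X2 = cvec Y1 + \<i> *s cvec Y2"
      unfolding quasi_real_def complex_tangent_sum_def tangent_sum_def rescale_def complexify_fam_def
      by auto
    have Y: "Y1 = X1" "Y2 = X2" using eq by (metis vRe_cvec, metis vIm_cvec)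
    obtain a1 a2 b1 b2 where
      a: "cvec X1 = P *v (cvec x1 + \<i> *s cvec a1)" "cvec X2 = P *v (cvec x2 + \<i> *s cvec a2)"
      and b: "cvec X1 = P *v (cvec b1 + \<i> *s cvec h1)" "cvec X2 = P *v (cvec b2 + \<i> *s cvec h2)"
      using c h unfolding check hat Y by blast
    \<comment> \<open>The lift built from the check data alone. The form part of \<open>V\<close>
      differs from it by i(h1 - a1) - (h2 - a2), which \<open>im\<close> shows to vanish on
      \<Delta>.\<close>
    let ?\<alpha> = "(cvec x1 + \<i> *s cvec a1) + \<i> *s (cvec x2 + \<i> *s cvec a2)"
    show "V \<in> qr_graph P" unfolding V
    proof (rule qr_graphI[of _ _ ?\<alpha>])
      show "cvec X1 + \<i> *s cvec X2 = P *v ?\<alpha>" by (simp only: a vec.add vec.scale)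
      show "cvec X1 + \<i> *s cvec X2 \<in> real_core P"
        using cvec_in_core[of X1 P] cvec_in_core[of X2 P] a
        by (metis core_parts_iff rangeI vIm_cvec vRe_cvec)
      fix Z assume "Z \<in> real_core P"
      moreover have "\<forall>Z\<in>real_core P. scalar_product
          ((cvec x1 + \<i> *s cvec x2 + \<i> *s (cvec h1 + \<i> *s cvec h2)) - ?\<alpha>) Z = 0"
        unfolding annihilates_core_iff
        using im[of x1 a1 b1 h1] im[of x2 a2 b2 h2] a b by (simp add: algebra_simps)
      ultimately show "scalar_product
          ((cvec x1 + \<i> *s cvec x2 + \<i> *s (cvec h1 + \<i> *s cvec h2)) - ?\<alpha>) Z = 0" by blast
    qed
  next
    fix V assume V: "V \<in> qr_graph P"
    obtain X \<xi> where VX: "V = (X, \<xi>)" by fastforce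
    obtain \<alpha> where \<alpha>: "X = P *v \<alpha>" and X: "X \<in> real_core P"
      and \<theta>: "\<And>Z. Z \<in> real_core P \<Longrightarrow> scalar_product (\<xi> - \<alpha>) Z = 0"
      using qr_graphE[OF V[unfolded VX]] by metis
    obtain \<alpha>1 \<alpha>2 where \<alpha>12: "cvec (vRe X) = P *v \<alpha>1" "cvec (vIm X) = P *v \<alpha>2"
      using core_parts[OF X] by (auto simp: real_core_def)
    \<comment> \<open>The part of \<xi> not accounted for by lifts of the real and imaginary parts
      of \<open>X\<close>. It annihilates the core and is absorbed into the check family.\<close>
    define \<psi> where "\<psi> = \<xi> - (\<alpha>1 + \<i> *s \<alpha>2)"
    have "P *v (\<alpha> - (\<alpha>1 + \<i> *s \<alpha>2)) = 0"
      using cvec_vRe_vIm[of X] by (simp add: vec.diff vec.add vec.scale \<alpha>12[symmetric] \<alpha>)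
    then have "scalar_product (\<alpha> - (\<alpha>1 + \<i> *s \<alpha>2)) Z = 0" if "Z \<in> real_core P" for Z
      using skew_kernel[OF skew] that unfolding real_core_def by blast
    then have "scalar_product \<psi> Z = 0" if "Z \<in> real_core P" for Z
      using \<theta>[OF that] that unfolding \<psi>_def by (fastforce simp: algebra_simps)
    then have "scalar_product \<psi> (cvec v) = 0" if "cvec v \<in> range ((*v) P)" for v
      using that by (simp add: cvec_in_core)
    then have "scalar_product (cvec (vRe \<psi>) + \<i> *s cvec (vIm \<psi>)) (cvec v) = 0"
      if "cvec v \<in> range ((*v) P)" for v using that by (simp add: cvec_vRe_vIm)
    then have \<psi>: "scalar_product (vRe \<psi>) v = 0" "scalar_product (vIm \<psi>) v = 0"
      if "cvec v \<in> range ((*v) P)" for v using that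
      by (simp_all add: scalar_product_cvec complex_eq_iff)
    \<comment> \<open>Completing the real forms \<open>vRe \<psi>\<close> and
      \<open>vIm \<psi>\<close> by imaginary parts gives annihilators of E, that is, elements of the
      kernel of \<open>P\<close>.\<close>
    obtain u w where
      "\<And>Z. Z \<in> range ((*v) P) \<Longrightarrow> scalar_product (cvec (vRe \<psi>) + \<i> *s cvec u) Z = 0"
      "\<And>Z. Z \<in> range ((*v) P) \<Longrightarrow> scalar_product (cvec (vIm \<psi>) + \<i> *s cvec w) Z = 0"
      using real_annihilator_lift[OF subspace_range \<psi>(1)] real_annihilator_lift[OF subspace_range \<psi>(2)]
      by metis
    then have uw: "P *v (cvec (vRe \<psi>) + \<i> *s cvec u) = 0" "P *v (cvec (vIm \<psi>) + \<i> *s cvec w) = 0"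
      by (simp_all only: skew_kernel[OF skew] ball_simps) auto
    have shift: "(cvec (vRe b + x) + \<i> *s cvec (vIm b + y)) = b + (cvec x + \<i> *s cvec y)" for b x y
      by (subst (3) cvec_vRe_vIm[of b, symmetric]) (simp add: algebra_simps)
    \<comment> \<open>Adding these kernel elements to \<open>\<alpha>1\<close> and
      \<open>\<alpha>2\<close> gives lifts whose real parts are shifted by \<open>vRe \<psi>\<close>
      and \<open>vIm \<psi>\<close>. The hat family uses the original lifts, which keeps their
      imaginary parts.\<close>
    have "(vRe X, vRe \<alpha>1 + vRe \<psi>) \<in> check_fam (biv_graph \<pi> p)"
      "(vIm X, vRe \<alpha>2 + vIm \<psi>) \<in> check_fam (biv_graph \<pi> p)"
      unfolding check \<alpha>12
      by (rule exI[of _ "vIm \<alpha>1 + u"], unfold shift, simp add: matrix_vector_right_distrib[of P \<alpha>1] uw)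
         (rule exI[of _ "vIm \<alpha>2 + w"], unfold shift, simp add: matrix_vector_right_distrib[of P \<alpha>2] uw)
    moreover have "(vRe X, vIm \<alpha>1) \<in> hat_fam (biv_graph \<pi> p)" "(vIm X, vIm \<alpha>2) \<in> hat_fam (biv_graph \<pi> p)"
      unfolding hat \<alpha>12 by (metis cvec_vRe_vIm)+
    moreover have "X = cvec (vRe X) + \<i> *s cvec (vIm X)" by (simp add: cvec_vRe_vIm)
    moreover have "\<xi> = (cvec (vRe \<alpha>1 + vRe \<psi>) + \<i> *s cvec (vRe \<alpha>2 + vIm \<psi>))
        + \<i> *s (cvec (vIm \<alpha>1) + \<i> *s cvec (vIm \<alpha>2))"
    proof -
      have "\<xi> = \<alpha>1 + \<i> *s \<alpha>2 + \<psi>" by (simp add: \<psi>_def)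
      then show ?thesis by (simp add: vec_eq_iff complex_eq_iff)
    qed
    ultimately show "V \<in> quasi_real (biv_graph \<pi>) p"
      unfolding quasi_real_def complex_tangent_sum_def tangent_sum_def rescale_def complexify_fam_def VX
      by blast
  qed
  then show ?thesis by (simp add: P_def)
qed

interpretation gt_space: vector_space_prod "(*s) :: complex \<Rightarrow> complex^'n \<Rightarrow> _" "(*s) :: complex \<Rightarrow> complex^'n \<Rightarrow> _"
  by unfold_locales

lemma cscale_eq: "cscale = gt_space.scale"
  by (intro ext) (simp add: cscale_def gt_space.scale_def)

text \<open>Isotropy comes from skewness, since on the core each form may be replaced by a lift.
  Maximality is tested directly, without counting dimensions: the elements (0, \<gamma>) with
  \<gamma> annihilating the core force the vector part into the core, and the elements (P \<alpha>,
  \<alpha>) over the core then determine the form part on the core.\<close>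

lemma lagrangian_qr_graph:
  assumes skew: "transpose P = - (P :: complex^'n::finite^'n)"
  shows "lagrangian (qr_graph P)"
  unfolding lagrangian_def
proof
  have c: "module.subspace cscale S \<longleftrightarrow> 0 \<in> S \<and> (\<forall>x\<in>S. \<forall>y\<in>S. x + y \<in> S) \<and> (\<forall>c. \<forall>x\<in>S. cscale c x \<in> S)"
    for S :: "((complex^'n) \<times> (complex^'n)) set"
    unfolding cscale_eq gt_space.p.subspace_def by blast
  show "module.subspace cscale (qr_graph P)"
    unfolding c
  proof (intro conjI ballI allI)
    show "0 \<in> qr_graph P" unfolding zero_prod_def
      by (rule qr_graphI[of _ _ 0]) (auto intro: vec.subspace_0 subspace_core)
  next
    fix x y assume *: "x \<in> qr_graph P" "y \<in> qr_graph P"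
    obtain X \<xi> Y \<eta> where xy: "x = (X, \<xi>)" "y = (Y, \<eta>)" by fastforce
    obtain \<alpha> \<beta> where "X = P *v \<alpha>" "X \<in> real_core P" "Y = P *v \<beta>" "Y \<in> real_core P"
      and "\<And>Z. Z \<in> real_core P \<Longrightarrow> scalar_product (\<xi> - \<alpha>) Z = 0"
        "\<And>Z. Z \<in> real_core P \<Longrightarrow> scalar_product (\<eta> - \<beta>) Z = 0"
      using *[unfolded xy] by (metis qr_graphE)
    then show "x + y \<in> qr_graph P"
      unfolding xy add_Pair
      by (intro qr_graphI[of _ _ "\<alpha> + \<beta>"])
         (auto intro!: vec.subspace_add subspace_core simp: matrix_vector_right_distrib algebra_simps)
  next
    fix z x assume *: "x \<in> qr_graph P"
    obtain X \<xi> where xy: "x = (X, \<xi>)" by fastforce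
    obtain \<alpha> where "X = P *v \<alpha>" "X \<in> real_core P"
      and \<theta>: "\<And>Z. Z \<in> real_core P \<Longrightarrow> scalar_product (\<xi> - \<alpha>) Z = 0"
      using *[unfolded xy] by (metis qr_graphE)
    then show "cscale z x \<in> qr_graph P"
      unfolding xy cscale_def fst_conv snd_conv
      by (intro qr_graphI[of _ _ "z *s \<alpha>"])
         (auto intro!: vec.subspace_scale subspace_core simp: vector_scalar_commute vec.scale
           simp flip: right_diff_distrib)
  qed
  show "qr_graph P = {v. \<forall>w\<in>qr_graph P. pairing v w = 0}"
  proof (intro equalityI subsetI CollectI ballI)
    fix v w assume *: "v \<in> qr_graph P" "w \<in> qr_graph P"
    obtain X \<xi> Y \<eta> where xy: "v = (X, \<xi>)" "w = (Y, \<eta>)" by fastforce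
    obtain \<alpha> \<beta> where \<alpha>: "X = P *v \<alpha>" and X: "X \<in> real_core P" and \<beta>: "Y = P *v \<beta>" and Y: "Y \<in> real_core P"
      and "\<And>Z. Z \<in> real_core P \<Longrightarrow> scalar_product (\<xi> - \<alpha>) Z = 0"
        "\<And>Z. Z \<in> real_core P \<Longrightarrow> scalar_product (\<eta> - \<beta>) Z = 0"
      using *[unfolded xy] by (metis qr_graphE)
    then have "scalar_product \<eta> X = scalar_product \<beta> X" "scalar_product \<xi> Y = scalar_product \<alpha> Y"
      by simp_all
    then show "pairing v w = 0"
      unfolding xy pairing_def using skew_scalar_product[OF skew, of \<alpha> \<beta>] by (simp add: \<alpha> \<beta>)
  next
    fix v assume "v \<in> {v. \<forall>w\<in>qr_graph P. pairing v w = 0}"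
    moreover obtain Y \<zeta> where v: "v = (Y, \<zeta>)" by fastforce
    ultimately have *: "scalar_product \<xi> Y + scalar_product \<zeta> X = 0" if "(X, \<xi>) \<in> qr_graph P" for X \<xi>
      using that by (fastforce simp: pairing_def)
    have Y: "Y \<in> real_core P"
    proof (rule ccontr)
      assume "Y \<notin> real_core P"
      from annihilator_separation[OF subspace_core this] obtain \<gamma> where
        \<gamma>: "\<And>w. w \<in> real_core P \<Longrightarrow> scalar_product \<gamma> w = 0" "scalar_product \<gamma> Y \<noteq> 0" by blast
      have "(0, \<gamma>) \<in> qr_graph P"
        by (rule qr_graphI[of _ _ 0]) (auto intro: vec.subspace_0 subspace_core \<gamma>)
      from *[OF this] \<gamma>(2) show False by simp
    qed
    then obtain \<beta> where \<beta>: "Y = P *v \<beta>" by (auto simp: real_core_def)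
    show "v \<in> qr_graph P" unfolding v
    proof (rule qr_graphI[OF \<beta> Y])
      fix Z assume Z: "Z \<in> real_core P"
      then obtain \<alpha> where \<alpha>: "Z = P *v \<alpha>" by (auto simp: real_core_def)
      have "(Z, \<alpha>) \<in> qr_graph P" by (rule qr_graphI[OF \<alpha> Z]) simp
      from *[OF this] show "scalar_product (\<zeta> - \<beta>) Z = 0"
        by (simp add: \<beta> skew_scalar_product[OF skew, of \<alpha> \<beta>] \<alpha>)
    qed
  qed
qed

section \<open>Equivariance of the pointwise constructions under real Jacobian matrices\<close>

lemma cmat_mult: "cmat (J ** K) = cmat J ** cmat K"
  by (simp add: cmat_def vec_eq_iff matrix_matrix_mult_def)

lemma cmat_1 [simp]: "cmat (mat 1) = mat 1"
  by (simp add: cmat_def vec_eq_iff mat_def)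

lemma cmat_cvec: "cmat J *v cvec v = cvec (J *v v)"
  by (simp add: cmat_def vec_eq_iff matrix_vector_mult_def)

lemma vcnj_cmat: "vcnj (cmat J *v v) = cmat J *v vcnj v"
  by (simp add: cmat_def vec_eq_iff matrix_vector_mult_def)

lemma matrix_inv_eq:
  fixes A B :: "real^'n::finite^'n"
  assumes "A ** B = mat 1" "B ** A = mat 1" shows "matrix_inv A = B"
proof -
  have "A ** matrix_inv A = mat 1 \<and> matrix_inv A ** A = mat 1"
    unfolding matrix_inv_def by (rule someI[where x = B]) (use assms in simp)
  then show ?thesis by (metis assms(2) matrix_mul_assoc matrix_mul_lid matrix_mul_rid)
qed

lemma act_TCM_mult: "act_TCM (J ** K) v = act_TCM J (act_TCM K v)"
  by (simp add: act_TCM_def matrix_vector_mul_assoc cmat_mult)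

lemma act_biv_mult: "act_biv (J ** K) P = act_biv J (act_biv K P)"
  by (simp add: act_biv_def cmat_mult matrix_transpose_mul matrix_mul_assoc)

text \<open>\<open>matrix_inv\<close> is determined only for invertible matrices, hence the explicit
  two-sided inverses here and below.\<close>

lemma act_CotCM_mult:
  assumes "J ** J' = mat 1" "J' ** J = mat 1" "K ** K' = mat 1" "K' ** K = mat 1"
  shows "act_CotCM (J ** K) v = act_CotCM J (act_CotCM K v)"
proof -
  have "matrix_inv (J ** K) = K' ** J'"
    by (rule matrix_inv_eq) (metis assms matrix_mul_assoc matrix_mul_rid)+
  then show ?thesis
    by (simp add: act_CotCM_def matrix_inv_eq[OF assms(1,2)] matrix_inv_eq[OF assms(3,4)]
        cmat_mult matrix_transpose_mul matrix_vector_mul_assoc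
        del: transpose_matrix_vector)
qed

lemma act_GTCM_mult:
  assumes "J ** J' = mat 1" "J' ** J = mat 1" "K ** K' = mat 1" "K' ** K = mat 1"
  shows "act_GTCM (J ** K) v = act_GTCM J (act_GTCM K v)"
  by (simp add: act_GTCM_def act_TCM_mult act_CotCM_mult[OF assms])

lemma act_biv_skew: "transpose P = - P \<Longrightarrow> transpose (act_biv J P) = - act_biv J P"
proof -
  assume *: "transpose P = - P"
  have m: "A ** (- B) = - (A ** B)" "(- A) ** B = - (A ** B)" for A B :: "complex^'n^'n"
    by (simp_all add: vec_eq_iff matrix_matrix_mult_def sum_negf)
  show ?thesis by (simp add: act_biv_def matrix_transpose_mul * m matrix_mul_assoc)
qed

lemma range_act_biv:
  assumes "J ** J' = mat 1" "J' ** J = mat 1"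
  shows "range ((*v) (act_biv J P)) = (*v) (cmat J) ` range ((*v) P)"
proof (intro equalityI subsetI)
  fix x assume "x \<in> range ((*v) (act_biv J P))"
  then show "x \<in> (*v) (cmat J) ` range ((*v) P)"
    by (auto simp: act_biv_def matrix_vector_mul_assoc[symmetric])
next
  fix x assume "x \<in> (*v) (cmat J) ` range ((*v) P)"
  then obtain a where x: "x = cmat J *v (P *v a)" by auto
  have "transpose (cmat J) ** transpose (cmat J') = mat 1"
    by (simp add: matrix_transpose_mul[symmetric] cmat_mult[symmetric] assms)
  then have "x = act_biv J P *v (transpose (cmat J') *v a)"
    unfolding x act_biv_def
    by (metis (no_types, lifting) matrix_mul_assoc matrix_mul_rid matrix_vector_mul_assoc)
  then show "x \<in> range ((*v) (act_biv J P))" by blast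
qed

text \<open>\<open>J\<close> is real, so \<open>cmat J\<close> commutes with conjugation and carries
  E \<inter> cnj E along with E.\<close>

lemma core_act_biv:
  assumes "J ** J' = mat 1" "J' ** J = mat 1"
  shows "real_core (act_biv J P) = (*v) (cmat J) ` real_core P"
proof -
  have inv: "cmat J' *v (cmat J *v z) = z" for z
    by (simp add: matrix_vector_mul_assoc cmat_mult[symmetric] assms)
  show ?thesis
    unfolding real_core_def range_act_biv[OF assms]
    by (auto simp: vcnj_cmat image_iff) (metis inv vcnj_cmat)+
qed

text \<open>If \<alpha> lifts X through \<open>P\<close>, its image under the transposed inverse
  lifts the image of X through \<open>act_biv J P\<close>, and the pairing of vectors with covectors
  is invariant.\<close>

lemma qr_graph_act:
  assumes J: "J ** J' = mat 1" "J' ** J = mat 1" and v: "v \<in> qr_graph P"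
  shows "act_GTCM J v \<in> qr_graph (act_biv J P)"
proof -
  obtain X \<xi> where vX: "v = (X, \<xi>)" by fastforce
  obtain \<alpha> where \<alpha>: "X = P *v \<alpha>" and X: "X \<in> real_core P"
    and \<theta>: "\<And>Z. Z \<in> real_core P \<Longrightarrow> scalar_product (\<xi> - \<alpha>) Z = 0"
    using qr_graphE[OF v[unfolded vX]] by metis
  have cot: "act_CotCM J = (*v) (transpose (cmat J'))"
    by (rule ext) (simp add: act_CotCM_def matrix_inv_eq[OF J])
  have t: "transpose (cmat J) *v (transpose (cmat J') *v a) = a" for a
    by (simp add: matrix_vector_mul_assoc matrix_transpose_mul[symmetric] cmat_mult[symmetric] J
        del: transpose_matrix_vector)
  show ?thesis
    unfolding vX act_GTCM_def fst_conv snd_conv cot act_TCM_def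
  proof (rule qr_graphI[of _ _ "transpose (cmat J') *v \<alpha>"])
    show "cmat J *v X = act_biv J P *v (transpose (cmat J') *v \<alpha>)"
      by (simp add: act_biv_def \<alpha> matrix_vector_mul_assoc[symmetric] t del: transpose_matrix_vector)
    show "cmat J *v X \<in> real_core (act_biv J P)" using X by (simp add: core_act_biv[OF J])
    fix Z assume "Z \<in> real_core (act_biv J P)"
    then obtain Z0 where Z: "Z = cmat J *v Z0" "Z0 \<in> real_core P" by (auto simp: core_act_biv[OF J])
    show "scalar_product (transpose (cmat J') *v \<xi> - transpose (cmat J') *v \<alpha>) Z = 0"
      using \<theta>[OF Z(2)] 
      by (simp add: Z(1) scalar_product_matrix vec.diff[symmetric] t
          del: transpose_matrix_vector scalar_product_simps)
  qed
qed

section \<open>Calculus of smooth functions\<close>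

lemma Ck_on_cong:
  assumes "open S" "\<And>x. x \<in> S \<Longrightarrow> f x = g x" "Ck_on k S f"
  shows "Ck_on k S g"
  using assms(2,3)
proof (induction k arbitrary: f g)
  case 0
  then show ?case using continuous_on_cong by force
next
  case (Suc k)
  have d: "g differentiable at x \<and> frechet_derivative f (at x) = frechet_derivative g (at x)"
    if x: "x \<in> S" for x
  proof -
    have "(f has_derivative frechet_derivative f (at x)) (at x)"
      using Suc.prems(2) x frechet_derivative_works by auto
    then have "(g has_derivative frechet_derivative f (at x)) (at x)"
      using has_derivative_transform_within_open[OF _ assms(1) x] Suc.prems(1) by blast
    then show ?thesis using frechet_derivative_at differentiable_def by blast
  qed
  have "Ck_on k S (\<lambda>x. frechet_derivative g (at x) v)" for v
  proof (rule Suc.IH)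
    show "Ck_on k S (\<lambda>x. frechet_derivative f (at x) v)" using Suc.prems(2) by simp
    show "frechet_derivative f (at x) v = frechet_derivative g (at x) v" if "x \<in> S" for x
      using d[OF that] by simp
  qed
  then show ?case using d by simp
qed

lemma Ck_on_subset: "Ck_on k S f \<Longrightarrow> T \<subseteq> S \<Longrightarrow> Ck_on k T f"
  by (induction k arbitrary: f) (auto intro: continuous_on_subset)

lemma Ck_on_Suc_imp: "Ck_on (Suc k) S f \<Longrightarrow> Ck_on k S f"
proof (induction k arbitrary: f)
  case 0
  then show ?case
    by (simp add: continuous_at_imp_continuous_on differentiable_imp_continuous_within)
next
  case (Suc k)
  then show ?case unfolding Ck_on.simps(2)[of "Suc k"] Ck_on.simps(2)[of k S f] by blast
qed

text \<open>The induction step for the closure properties below: any explicit formula for the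
  derivative may be used, and only has to be of class k in each fixed direction.\<close>

lemma Ck_on_SucI:
  assumes "open S" "\<And>x. x \<in> S \<Longrightarrow> (f has_derivative f' x) (at x)"
    and "\<And>v. Ck_on k S (\<lambda>x. f' x v)"
  shows "Ck_on (Suc k) S f"
proof -
  have "frechet_derivative f (at x) = f' x" if "x \<in> S" for x
    using assms(2)[OF that] frechet_derivative_at by metis
  then have "Ck_on k S (\<lambda>x. frechet_derivative f (at x) v)" for v
    by (intro Ck_on_cong[OF assms(1) _ assms(3)[of v]]) simp
  then show ?thesis using assms(2) by (auto intro: differentiableI)
qed

lemma Ck_on_SucD:
  assumes "Ck_on (Suc k) S f" "x \<in> S"
  shows "(f has_derivative frechet_derivative f (at x)) (at x)"
  using assms frechet_derivative_works by auto

lemma Ck_on_const [simp]: "Ck_on k S (\<lambda>x. c)"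
  by (induction k arbitrary: c) auto

lemma Ck_on_bounded_linear:
  assumes h: "bounded_linear h" and S: "open S" and f: "Ck_on k S f"
  shows "Ck_on k S (\<lambda>x. h (f x))"
  using f
proof (induction k arbitrary: f)
  case 0
  then show ?case using bounded_linear.continuous_on[OF h] by auto
next
  case (Suc k)
  show ?case
    by (rule Ck_on_SucI[OF S bounded_linear.has_derivative[OF h Ck_on_SucD[OF Suc.prems]]], assumption)
       (intro Suc.IH; use Suc.prems in simp)
qed

lemma Ck_on_add:
  assumes S: "open S" and "Ck_on k S f" "Ck_on k S g"
  shows "Ck_on k S (\<lambda>x. f x + g x)"
  using assms(2,3)
proof (induction k arbitrary: f g)
  case 0
  then show ?case by (auto intro: continuous_on_add)
next
  case (Suc k)
  show ?case
    by (rule Ck_on_SucI[OF S has_derivative_add[OF Ck_on_SucD[OF Suc.prems(1)] Ck_on_SucD[OF Suc.prems(2)]]], assumption+)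
       (intro Suc.IH; use Suc.prems in simp)
qed

lemma Ck_on_bilinear:
  assumes p: "bounded_bilinear bl" and S: "open S" and "Ck_on k S f" "Ck_on k S g"
  shows "Ck_on k S (\<lambda>x. bl (f x) (g x))"
  using assms(3,4)
proof (induction k arbitrary: f g)
  case 0
  then show ?case using bounded_bilinear.continuous_on[OF p] by auto
next
  case (Suc k)
  show ?case
    by (rule Ck_on_SucI[OF S bounded_bilinear.FDERIV[OF p Ck_on_SucD[OF Suc.prems(1)] Ck_on_SucD[OF Suc.prems(2)]]], assumption+)
       (intro Ck_on_add[OF S] Suc.IH; use Suc.prems Suc.prems[THEN Ck_on_Suc_imp] in simp)
qed

lemma Ck_on_sum:
  assumes "open S" "\<And>i. i \<in> I \<Longrightarrow> Ck_on k S (f i)"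
  shows "Ck_on k S (\<lambda>x. \<Sum>i\<in>I. f i x)"
  using assms(2) by (induction I rule: infinite_finite_induct) (auto intro: Ck_on_add[OF assms(1)])

lemma Ck_on_prod:
  fixes f :: "'i \<Rightarrow> 'x::real_normed_vector \<Rightarrow> 'y::real_normed_field"
  assumes "open S" "\<And>i. i \<in> I \<Longrightarrow> Ck_on k S (f i)"
  shows "Ck_on k S (\<lambda>x. \<Prod>i\<in>I. f i x)"
  using assms(2)
  by (induction I rule: infinite_finite_induct)
     (auto intro: Ck_on_bilinear[OF bounded_bilinear_mult assms(1)])

lemma Ck_on_inverse:
  fixes f :: "'x::real_normed_vector \<Rightarrow> 'y::real_normed_field"
  assumes S: "open S" and "Ck_on k S f" and nz: "\<And>x. x \<in> S \<Longrightarrow> f x \<noteq> 0"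
  shows "Ck_on k S (\<lambda>x. inverse (f x))"
  using assms(2)
proof (induction k)
  case 0
  then show ?case using nz by (auto intro: continuous_on_inverse)
next
  case (Suc k)
  note m = Ck_on_bilinear[OF bounded_bilinear_mult S]
  have "Ck_on k S (\<lambda>x. (- 1) * (inverse (f x) * frechet_derivative f (at x) v * inverse (f x)))" for v
    using Suc.prems Ck_on_Suc_imp[OF Suc.prems] by (intro m Suc.IH) auto
  then show ?case
    by (intro Ck_on_SucI[OF S Deriv.has_derivative_inverse[OF nz Ck_on_SucD[OF Suc.prems]]]) auto
qed

text \<open>\<open>Ck_on\<close> differentiates in fixed directions, whereas the chain rule
  evaluates the derivative of \<open>f\<close> in a direction that varies with x. Expanding this
  direction in \<open>Basis\<close> leaves derivatives of \<open>f\<close> in fixed directions, to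
  which the induction hypothesis applies; therefore \<open>f\<close> is arbitrary in the induction
  and has a euclidean domain.\<close>

lemma Ck_on_compose:
  fixes f :: "'e::euclidean_space \<Rightarrow> 'y::real_normed_vector"
  assumes S: "open S" and gS: "g ` S \<subseteq> T" and "Ck_on k T f" and "Ck_on k S g"
  shows "Ck_on k S (\<lambda>x. f (g x))"
  using assms(3,4)
proof (induction k arbitrary: f)
  case 0
  then show ?case using gS by (auto intro: continuous_on_compose2)
next
  case (Suc k)
  have "((\<lambda>x. f (g x)) has_derivative
      (\<lambda>v. \<Sum>b\<in>Basis. (frechet_derivative g (at x) v \<bullet> b) *\<^sub>R frechet_derivative f (at (g x)) b)) (at x)"
    if x: "x \<in> S" for x
  proof -
    have f: "(f has_derivative frechet_derivative f (at (g x))) (at (g x))"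
      using Ck_on_SucD[OF Suc.prems(1), of "g x"] gS x by blast
    interpret f: bounded_linear "frechet_derivative f (at (g x))"
      using has_derivative_bounded_linear[OF f] .
    have *: "frechet_derivative f (at (g x)) w = (\<Sum>b\<in>Basis. (w \<bullet> b) *\<^sub>R frechet_derivative f (at (g x)) b)" for w
    proof -
      have "frechet_derivative f (at (g x)) (\<Sum>b\<in>Basis. (w \<bullet> b) *\<^sub>R b) =
          (\<Sum>b\<in>Basis. (w \<bullet> b) *\<^sub>R frechet_derivative f (at (g x)) b)"
        by (simp only: f.sum f.scale)
      then show ?thesis by (simp only: euclidean_representation)
    qed
    show ?thesis
      using has_derivative_compose[OF Ck_on_SucD[OF Suc.prems(2) x] f] by (simp only: *[symmetric])
  qed
  moreover have "Ck_on k S (\<lambda>x. \<Sum>b\<in>Basis. (frechet_derivative g (at x) v \<bullet> b) *\<^sub>R frechet_derivative f (at (g x)) b)"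
    for v
    using Suc.prems Ck_on_Suc_imp[OF Suc.prems(2)]
    by (intro Ck_on_sum[OF S] Ck_on_bilinear[OF bounded_bilinear_scaleR S] Suc.IH
        Ck_on_bounded_linear[OF bounded_linear_inner_left S]) auto
  ultimately show ?case by (intro Ck_on_SucI[OF S])
qed

section \<open>Closure properties of smooth maps, including matrix inversion\<close>

lemma smooth_on_cong: "open S \<Longrightarrow> (\<And>x. x \<in> S \<Longrightarrow> f x = g x) \<Longrightarrow> smooth_on S f \<Longrightarrow> smooth_on S g"
  unfolding smooth_on_def using Ck_on_cong by blast

lemma smooth_on_subset: "smooth_on S f \<Longrightarrow> T \<subseteq> S \<Longrightarrow> smooth_on T f"
  unfolding smooth_on_def using Ck_on_subset by blast

lemma smooth_on_const [simp]: "smooth_on S (\<lambda>x. c)"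
  by (simp add: smooth_on_def)

lemma smooth_on_bounded_linear:
  "bounded_linear h \<Longrightarrow> open S \<Longrightarrow> smooth_on S f \<Longrightarrow> smooth_on S (\<lambda>x. h (f x))"
  by (simp add: smooth_on_def Ck_on_bounded_linear)

lemma smooth_on_add: "open S \<Longrightarrow> smooth_on S f \<Longrightarrow> smooth_on S g \<Longrightarrow> smooth_on S (\<lambda>x. f x + g x)"
  by (simp add: smooth_on_def Ck_on_add)

lemma smooth_on_sum:
  "open S \<Longrightarrow> (\<And>i. i \<in> I \<Longrightarrow> smooth_on S (f i)) \<Longrightarrow> smooth_on S (\<lambda>x. \<Sum>i\<in>I. f i x)"
  by (simp add: smooth_on_def Ck_on_sum)

lemma smooth_on_prod:
  fixes f :: "'i \<Rightarrow> 'x::real_normed_vector \<Rightarrow> 'y::real_normed_field"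
  shows "open S \<Longrightarrow> (\<And>i. i \<in> I \<Longrightarrow> smooth_on S (f i)) \<Longrightarrow> smooth_on S (\<lambda>x. \<Prod>i\<in>I. f i x)"
  by (simp add: smooth_on_def Ck_on_prod)

lemma smooth_on_mult:
  fixes f g :: "'x::real_normed_vector \<Rightarrow> 'y::real_normed_field"
  shows "open S \<Longrightarrow> smooth_on S f \<Longrightarrow> smooth_on S g \<Longrightarrow> smooth_on S (\<lambda>x. f x * g x)"
  by (simp add: smooth_on_def Ck_on_bilinear[OF bounded_bilinear_mult])

lemma smooth_on_divide:
  fixes f g :: "'x::real_normed_vector \<Rightarrow> 'y::real_normed_field"
  shows "open S \<Longrightarrow> smooth_on S f \<Longrightarrow> smooth_on S g \<Longrightarrow> (\<And>x. x \<in> S \<Longrightarrow> g x \<noteq> 0) \<Longrightarrow>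
    smooth_on S (\<lambda>x. f x / g x)"
  unfolding divide_inverse
  by (intro smooth_on_mult) (auto simp: smooth_on_def Ck_on_inverse)

lemma smooth_on_diff:
  fixes f g :: "'x::real_normed_vector \<Rightarrow> 'y::real_normed_vector"
  shows "open S \<Longrightarrow> smooth_on S f \<Longrightarrow> smooth_on S g \<Longrightarrow> smooth_on S (\<lambda>x. f x - g x)"
  using smooth_on_add[of S f "\<lambda>x. - g x"]
    smooth_on_bounded_linear[OF bounded_linear_minus[OF bounded_linear_ident], of S g] by simp

lemma smooth_on_compose:
  fixes f :: "'e::euclidean_space \<Rightarrow> 'y::real_normed_vector"
  shows "open S \<Longrightarrow> g ` S \<subseteq> T \<Longrightarrow> smooth_on T f \<Longrightarrow> smooth_on S g \<Longrightarrow> smooth_on S (\<lambda>x. f (g x))"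
  unfolding smooth_on_def using Ck_on_compose by blast

lemma smooth_on_frechet_derivative: "smooth_on S f \<Longrightarrow> smooth_on S (\<lambda>x. frechet_derivative f (at x) v)"
  unfolding smooth_on_def by (metis Ck_on.simps(2))

lemma smooth_on_imp_continuous_on: "smooth_on S f \<Longrightarrow> continuous_on S f"
  unfolding smooth_on_def by (metis Ck_on.simps(1))

lemma smooth_on_imp_differentiable: "smooth_on S f \<Longrightarrow> x \<in> S \<Longrightarrow> f differentiable at x"
  unfolding smooth_on_def by (metis Ck_on.simps(2))

lemma bounded_linear_axis: "bounded_linear (axis i :: 'y::real_normed_vector \<Rightarrow> 'y^'n::finite)"
proof (rule bounded_linear_intro[where K = 1])
  show "norm (axis i x :: 'y^'n) \<le> norm x * 1" for x :: 'y
  proof -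
    have "norm (axis i x :: 'y^'n) \<le> (\<Sum>j\<in>UNIV. norm ((axis i x :: 'y^'n) $ j))"
      unfolding norm_vec_def by (rule L2_set_le_sum) simp
    also have "\<dots> = (\<Sum>j\<in>UNIV. if j = i then norm x else 0)"
      by (rule sum.cong) (auto simp: axis_def)
    finally show ?thesis by simp
  qed
qed (auto simp: axis_def vec_eq_iff)

lemma smooth_on_nth: "open S \<Longrightarrow> smooth_on S f \<Longrightarrow> smooth_on S (\<lambda>x. f x $ i)"
  by (rule smooth_on_bounded_linear[OF bounded_linear_vec_nth])

lemma smooth_on_vec:
  fixes f :: "'x::real_normed_vector \<Rightarrow> 'y::real_normed_vector^'n::finite"
  assumes "open S" "\<And>i. smooth_on S (\<lambda>x. f x $ i)"
  shows "smooth_on S f"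
proof -
  have "f = (\<lambda>x. \<Sum>i\<in>UNIV. axis i (f x $ i))"
    by (simp add: fun_eq_iff vec_eq_iff axis_def)
  moreover have "smooth_on S (\<lambda>x. \<Sum>i\<in>UNIV. axis i (f x $ i))"
    by (intro smooth_on_sum smooth_on_bounded_linear[OF bounded_linear_axis] assms)
  ultimately show ?thesis by simp
qed

lemma smooth_on_Pair:
  assumes "open S" "smooth_on S f" "smooth_on S g"
  shows "smooth_on S (\<lambda>x. (f x, g x))"
proof -
  have "bounded_linear (\<lambda>x::'b. (x, 0::'c))" "bounded_linear (\<lambda>x::'c. (0::'b, x))"
    by (intro bounded_linear_Pair bounded_linear_ident bounded_linear_zero)+
  then have "smooth_on S (\<lambda>x. (f x, 0) + (0, g x))"
    by (intro smooth_on_add smooth_on_bounded_linear[where h = "\<lambda>x. (x, 0)"]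
        smooth_on_bounded_linear[where h = "\<lambda>x. (0, x)"] assms)
  then show ?thesis by simp
qed

lemma smooth_on_fst: "open S \<Longrightarrow> smooth_on S f \<Longrightarrow> smooth_on S (\<lambda>x. fst (f x))"
  and smooth_on_snd: "open S \<Longrightarrow> smooth_on S f \<Longrightarrow> smooth_on S (\<lambda>x. snd (f x))"
  by (auto intro: smooth_on_bounded_linear bounded_linear_fst bounded_linear_snd)

lemma smooth_on_matrix_vector:
  fixes K :: "'x::real_normed_vector \<Rightarrow> 'y::real_normed_field^'n::finite^'m::finite"
  assumes S: "open S" and K: "\<And>i j. smooth_on S (\<lambda>x. K x $ i $ j)" and "smooth_on S v"
  shows "smooth_on S (\<lambda>x. K x *v v x)"
  by (rule smooth_on_vec[OF S])
     (simp add: matrix_vector_mult_def, intro smooth_on_sum smooth_on_mult S K smooth_on_nth assms)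

lemma smooth_on_det:
  fixes K :: "'x::real_normed_vector \<Rightarrow> 'y::real_normed_field^'n::finite^'n"
  assumes S: "open S" and K: "\<And>i j. smooth_on S (\<lambda>x. K x $ i $ j)"
  shows "smooth_on S (\<lambda>x. det (K x))"
  unfolding det_def by (intro smooth_on_sum smooth_on_mult smooth_on_prod smooth_on_const S K)

lemma matrix_inv_solve:
  fixes K :: "'y::field^'n::finite^'n"
  assumes "det K \<noteq> 0"
  shows "K *v (matrix_inv K *v b) = b" "matrix_inv K *v (K *v b) = b"
proof -
  have "\<exists>L. K ** L = mat 1 \<and> L ** K = mat 1" using assms invertible_det_nz[of K] invertible_def by blast
  then have "K ** matrix_inv K = mat 1 \<and> matrix_inv K ** K = mat 1"
    unfolding matrix_inv_def by (rule someI_ex)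
  then show "K *v (matrix_inv K *v b) = b" "matrix_inv K *v (K *v b) = b"
    by (simp_all add: matrix_vector_mul_assoc)
qed

text \<open>By Cramer's rule the entries of the solution are quotients of determinants, which are
  polynomial in the data.\<close>

lemma smooth_on_matrix_inv:
  fixes K :: "'x::real_normed_vector \<Rightarrow> 'y::real_normed_field^'n::finite^'n"
  assumes S: "open S" and K: "\<And>i j. smooth_on S (\<lambda>x. K x $ i $ j)" and v: "smooth_on S v"
    and nz: "\<And>x. x \<in> S \<Longrightarrow> det (K x) \<noteq> 0"
  shows "smooth_on S (\<lambda>x. matrix_inv (K x) *v v x)"
proof (rule smooth_on_cong[OF S])
  let ?f = "\<lambda>x. \<chi> k. det (\<chi> i j. if j = k then v x $ i else K x $ i $ j) / det (K x)"
  show "?f x = matrix_inv (K x) *v v x" if "x \<in> S" for x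
    using cramer[OF nz[OF that], of "matrix_inv (K x) *v v x"] matrix_inv_solve(1)[OF nz[OF that]] by metis
  show "smooth_on S ?f"
  proof (rule smooth_on_vec[OF S], simp, intro smooth_on_divide smooth_on_det S K nz)
    fix k i j show "smooth_on S (\<lambda>x. (\<chi> i j. if j = k then v x $ i else K x $ i $ j) $ i $ j)"
      by (cases "j = k") (simp_all add: K smooth_on_nth[OF S v])
  qed
qed

section \<open>Local frames and lifts in a chart\<close>

text \<open>Such a matrix picks lifts linearly; it is fixed at a base point and reused at nearby
  points.\<close>

lemma generalized_inverse:
  fixes P :: "'a::field^'n::finite^'m::finite"
  obtains R :: "'a^'m^'n" where "\<And>v. v \<in> range ((*v) P) \<Longrightarrow> P *v (R *v v) = v"
proof -
  obtain g where g: "Vector_Spaces.linear (*s) (*s) g" "\<forall>v\<in>range ((*v) P). P *v (g v) = v"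
    using vec.linear_exists_right_inverse_on[OF matrix_vector_mul_linear_gen vec.subspace_UNIV, of P]
    by blast
  show ?thesis by (rule that[of "matrix g"]) (simp add: matrix_works[OF g(1)] g(2))
qed

definition range_transport ::
  "complex^'n^'n \<Rightarrow> complex^'n^'n \<Rightarrow> complex^'n^'n \<Rightarrow> complex^'n::finite^'n" where
  "range_transport P0 R P = mat 1 + (P - P0) ** R"

text \<open>If \<open>R\<close> is a generalized inverse of \<open>P0\<close>, then \<open>1 + (P - P0) R\<close> agrees with \<open>P R\<close> on the range
  of \<open>P0\<close>, so it maps this range onto the range of \<open>P\<close> as long as the ranks agree.\<close>

lemma lift_along_range:
  fixes P P0 R :: "complex^'n::finite^'n"
  assumes R: "\<And>v. v \<in> range ((*v) P0) \<Longrightarrow> P0 *v (R *v v) = v"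
    and det: "det (range_transport P0 R P) \<noteq> 0"
    and dim: "vec.dim (range ((*v) P)) = vec.dim (range ((*v) P0))"
    and X: "X \<in> range ((*v) P)"
  shows "P *v (R *v (matrix_inv (range_transport P0 R P) *v X)) = X"
proof -
  let ?M = "range_transport P0 R P"
  have M: "?M *v v = P *v (R *v v)" if "v \<in> range ((*v) P0)" for v
    using R[OF that]
    by (simp add: range_transport_def matrix_vector_mult_add_rdistrib matrix_vector_mult_diff_rdistrib
        matrix_vector_mul_assoc[symmetric])
  have inj: "inj ((*v) ?M)" by (rule inj_on_inverseI) (rule matrix_inv_solve(2)[OF det])
  \<comment> \<open>Injectivity and equal dimensions turn the inclusion into an equality, so
    \<open>X\<close> is \<open>?M *v w\<close> for some w in the range of \<open>P0\<close>, where
    \<open>?M\<close> acts as \<open>P\<close> after \<open>R\<close>.\<close>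
  have "(*v) ?M ` range ((*v) P0) = range ((*v) P)"
  proof (rule vec.subspace_dim_equal)
    show "vec.subspace ((*v) ?M ` range ((*v) P0))"
      by (rule vec.subspace_image[OF subspace_range])
    show "vec.subspace (range ((*v) P))" by (rule subspace_range)
    show "(*v) ?M ` range ((*v) P0) \<subseteq> range ((*v) P)" using M by (metis image_subsetI rangeI)
    have "vec.dim ((*v) ?M ` range ((*v) P0)) = vec.dim (range ((*v) P0))"
      by (rule vec.dim_image_eq[OF matrix_vector_mul_linear_gen]) (meson inj inj_on_subset subset_UNIV)
    then show "vec.dim ((*v) ?M ` range ((*v) P0)) \<ge> vec.dim (range ((*v) P))" using dim by simp
  qed
  then obtain w where "w \<in> range ((*v) P0)" "X = ?M *v w" using X by auto
  then show ?thesis using M matrix_inv_solve(2)[OF det, of w] by metis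
qed

text \<open>The core is the complexification of its real vectors, so a real matrix that matches the
  real vectors matches the cores.\<close>

lemma core_transport:
  assumes "(*v) N ` {v. cvec v \<in> range ((*v) P0)} = {v. cvec v \<in> range ((*v) P)}"
  shows "(*v) (cmat N) ` real_core P0 = real_core P"
proof (intro equalityI subsetI)
  have imp: "cvec (N *v v) \<in> real_core P" if "cvec v \<in> real_core P0" for v
    using assms that by (auto simp: cvec_in_core)
  fix X assume "X \<in> (*v) (cmat N) ` real_core P0"
  then obtain Z where Z: "Z \<in> real_core P0" "X = cmat N *v Z" by blast
  have "X = cvec (N *v vRe Z) + \<i> *s cvec (N *v vIm Z)"
    unfolding Z(2) by (subst (1) cvec_vRe_vIm[symmetric])
      (simp only: matrix_vector_right_distrib vec.scale cmat_cvec)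
  then show "X \<in> real_core P"
    using imp core_parts[OF Z(1)] core_parts_iff[of X] by simp
next
  have imp: "\<exists>w. cvec w \<in> real_core P0 \<and> v = N *v w" if "cvec v \<in> real_core P" for v
  proof -
    have "v \<in> (*v) N ` {v. cvec v \<in> range ((*v) P0)}" using assms that by (simp add: cvec_in_core)
    then show ?thesis by (auto simp: cvec_in_core)
  qed
  fix X assume "X \<in> real_core P"
  then obtain u w where uw: "cvec u \<in> real_core P0" "cvec w \<in> real_core P0" "vRe X = N *v u" "vIm X = N *v w"
    using imp core_parts by metis
  then have "cmat N *v (cvec u + \<i> *s cvec w) = cvec (vRe X) + \<i> *s cvec (vIm X)"
    by (simp only: matrix_vector_right_distrib vec.scale cmat_cvec)
  then have "X = cmat N *v (cvec u + \<i> *s cvec w)" by (simp only: cvec_vRe_vIm)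
  moreover have "cvec u + \<i> *s cvec w \<in> real_core P0" using uw by (simp add: core_parts_iff[of "_ + _"])
  ultimately show "X \<in> (*v) (cmat N) ` real_core P0" by blast
qed

section \<open>Smooth transport of the fibres near a point\<close>

text \<open>At the base point \<open>R\<close> chooses a lift of the vector part, at the nearby
  point \<open>R\<close> after \<open>matrix_inv M\<close> does. The map moves the vector by
  \<open>N\<close>, exchanges one lift for the other, and moves the remaining form by the inverse
  transpose of \<open>N\<close>.\<close>

definition qr_transport ::
  "complex^'n^'n \<Rightarrow> complex^'n^'n \<Rightarrow> complex^'n^'n \<Rightarrow> (complex^'n) \<times> (complex^'n) \<Rightarrow>
   (complex^'n) \<times> (complex^'n::finite)" where
  "qr_transport R M N v = (N *v fst v,
     R *v (matrix_inv M *v (N *v fst v)) + matrix_inv (transpose N) *v (snd v - R *v fst v))"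

lemma qr_transport_linear:
  "Vector_Spaces.linear cscale cscale (qr_transport R M N)"
proof -
  have "vector_space (cscale :: complex \<Rightarrow> (complex^'a) \<times> (complex^'a) \<Rightarrow> _)"
    unfolding cscale_eq by (rule gt_space.p.vector_space_axioms)
  then show ?thesis
    by (intro Vector_Spaces.linear.intro module_hom.intro module_hom_axioms.intro)
       (auto simp: vector_space_def module_def qr_transport_def cscale_def vec.add vec.diff vec.scale
         vec_eq_iff algebra_simps)
qed

text \<open>An element lies in the fibre iff its vector is in the core and its form minus a chosen
  lift annihilates the core. With the lifts built into \<open>qr_transport\<close> these conditions
  correspond exactly, because \<open>N\<close> and its inverse transpose preserve the
  pairing.\<close>

lemma qr_transport_image:
  fixes P P0 R M N :: "complex^'n::finite^'n"
  assumes R: "\<And>v. v \<in> range ((*v) P0) \<Longrightarrow> P0 *v (R *v v) = v"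
    and lift: "\<And>X. X \<in> range ((*v) P) \<Longrightarrow> P *v (R *v (matrix_inv M *v X)) = X"
    and N: "(*v) N ` real_core P0 = real_core P" and det: "det N \<noteq> 0"
    and skew: "transpose P = - P" "transpose P0 = - P0"
  shows "inj (qr_transport R M N)" "qr_transport R M N ` qr_graph P0 = qr_graph P"
proof -
  have dt: "det (transpose N) \<noteq> 0" using det by simp
  note inv = matrix_inv_solve[OF det] matrix_inv_solve[OF dt]
  have injN: "N *v x = N *v y \<longleftrightarrow> x = y" for x y by (metis inv(2))
  have injT: "matrix_inv (transpose N) *v x = matrix_inv (transpose N) *v y \<longleftrightarrow> x = y" for x y
    by (metis inv(3))
  have sp: "scalar_product (matrix_inv (transpose N) *v \<theta>) (N *v Z) = scalar_product \<theta> Z" for \<theta> Z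
    by (simp only: scalar_product_matrix inv(3))
  \<comment> \<open>The existential lift in \<open>qr_graph\<close> is replaced by a prescribed one.
    The lift property is conditional on \<open>X\<close> being in the core, since \<open>R\<close>
    and \<open>lift\<close> produce lifts only for vectors in the range.\<close>
  have q: "(X, \<xi>) \<in> qr_graph P' \<longleftrightarrow> X \<in> real_core P' \<and> (\<forall>Z\<in>real_core P'. scalar_product (\<xi> - \<alpha>) Z = 0)"
    if "X \<in> real_core P' \<Longrightarrow> P' *v \<alpha> = X" and skew: "transpose P' = - P'" for X \<xi> \<alpha> and P' :: "complex^'n^'n"
  proof
    assume "(X, \<xi>) \<in> qr_graph P'"
    then obtain \<beta> where \<beta>: "X = P' *v \<beta>" and X: "X \<in> real_core P'"
      and *: "\<And>Z. Z \<in> real_core P' \<Longrightarrow> scalar_product (\<xi> - \<beta>) Z = 0"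
      by (blast elim: qr_graphE)
    have "P' *v (\<beta> - \<alpha>) = 0" using that(1)[OF X] \<beta> by (simp add: vec.diff)
    then have "scalar_product (\<beta> - \<alpha>) Z = 0" if "Z \<in> real_core P'" for Z
      using that skew_kernel[OF skew] unfolding real_core_def by blast
    then have "scalar_product (\<xi> - \<beta>) Z + scalar_product (\<beta> - \<alpha>) Z = 0" if "Z \<in> real_core P'" for Z
      using that *[OF that] by simp
    then show "X \<in> real_core P' \<and> (\<forall>Z\<in>real_core P'. scalar_product (\<xi> - \<alpha>) Z = 0)" using X by simp
  next
    assume *: "X \<in> real_core P' \<and> (\<forall>Z\<in>real_core P'. scalar_product (\<xi> - \<alpha>) Z = 0)"
    show "(X, \<xi>) \<in> qr_graph P'" using * that(1) by (intro qr_graphI[of _ _ \<alpha>]) auto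
  qed
  have cr: "X \<in> real_core P' \<Longrightarrow> X \<in> range ((*v) P')" for X P' by (simp add: real_core_def)
  have q0: "(X, \<xi>) \<in> qr_graph P0 \<longleftrightarrow> X \<in> real_core P0 \<and> (\<forall>Z\<in>real_core P0. scalar_product (\<xi> - R *v X) Z = 0)" for X \<xi>
    by (rule q[OF R[OF cr] skew(2)])
  have q1: "(X, \<xi>) \<in> qr_graph P \<longleftrightarrow> X \<in> real_core P \<and>
      (\<forall>Z\<in>real_core P. scalar_product (\<xi> - R *v (matrix_inv M *v X)) Z = 0)" for X \<xi>
    by (rule q[OF lift[OF cr] skew(1)])
  have Ncore: "N *v X \<in> real_core P \<longleftrightarrow> X \<in> real_core P0" for X
    unfolding N[symmetric] image_iff by (auto simp: injN)
  show "inj (qr_transport R M N)"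
    by (rule injI) (auto simp: qr_transport_def injN injT prod_eq_iff)
  have mem: "qr_transport R M N v \<in> qr_graph P \<longleftrightarrow> v \<in> qr_graph P0" for v
  proof -
    obtain X \<xi> where v: "v = (X, \<xi>)" by fastforce
    show ?thesis
      unfolding v q0 qr_transport_def q1 fst_conv snd_conv Ncore add_diff_cancel_left'
      unfolding N[symmetric] ball_simps sp ..
  qed
  show "qr_transport R M N ` qr_graph P0 = qr_graph P"
  proof (intro equalityI subsetI)
    fix w assume w: "w \<in> qr_graph P"
    obtain Y \<zeta> where Y: "w = (Y, \<zeta>)" by fastforce
    let ?X = "matrix_inv N *v Y"
    \<comment> \<open>Obtained by solving the two components of \<open>qr_transport\<close> for a
      preimage of \<open>w\<close>.\<close>
    let ?v = "(?X, R *v ?X + transpose N *v (\<zeta> - R *v (matrix_inv M *v Y)))"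
    have "qr_transport R M N ?v = w"
      unfolding qr_transport_def fst_conv snd_conv inv(1) add_diff_cancel_left' inv(4) Y by simp
    then show "w \<in> qr_transport R M N ` qr_graph P0" using w mem by (metis image_eqI)
  qed (use mem in auto)
qed

text \<open>With functionals f_j dual to the frame at \<open>x0\<close>, the map sending v to v plus
  the sum of the f_j(v) (s_j(x) - s_j(x0)) takes s_j(x0) to s_j(x), is smooth in x, and is the
  identity at \<open>x0\<close>.\<close>

lemma frame_transport:
  fixes s :: "nat \<Rightarrow> 'x::real_normed_vector \<Rightarrow> real^'n::finite"
  assumes S: "open S" and x0: "x0 \<in> S" and sm: "\<And>j. j < k \<Longrightarrow> smooth_on S (s j)"
    and inj: "inj_on (\<lambda>j. s j x0) {..<k}" and ind: "independent ((\<lambda>j. s j x0) ` {..<k})"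
    and span: "\<And>x. x \<in> S \<Longrightarrow> span ((\<lambda>j. s j x) ` {..<k}) = D x"
  obtains N :: "'x \<Rightarrow> real^'n^'n" where "\<And>i j. smooth_on S (\<lambda>x. N x $ i $ j)" "N x0 = mat 1"
    "\<And>x. x \<in> S \<Longrightarrow> (*v) (N x) ` D x0 = D x"
proof -
  have "\<exists>f. linear f \<and> (\<forall>i<k. f (s i x0) = (if i = j then 1 else (0::real)))" for j
  proof -
    \<comment> \<open>\<open>the_inv_into\<close> recovers the index of a frame vector, so that the
      dual functional can be prescribed on the set of these vectors.\<close>
    obtain f where f: "linear f" "\<And>y. y \<in> (\<lambda>j. s j x0) ` {..<k} \<Longrightarrow>
        f y = (if the_inv_into {..<k} (\<lambda>j. s j x0) y = j then 1 else (0::real))"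
      using linear_independent_extend[OF ind, of "\<lambda>y. if the_inv_into {..<k} (\<lambda>j. s j x0) y = j then 1 else 0"]
      by blast
    have "f (s i x0) = (if i = j then 1 else 0)" if "i < k" for i
      using f(2)[of "s i x0"] that the_inv_into_f_f[OF inj, of i] by auto
    then show ?thesis using f(1) by blast
  qed
  then obtain f where lin: "\<And>j. linear (f j)" and f: "\<And>i j. i < k \<Longrightarrow> f j (s i x0) = (if i = j then 1 else (0::real))"
    by metis
  define g where "g x v = v + (\<Sum>j<k. f j v *\<^sub>R (s j x - s j x0))" for x v
  have g: "linear (g x)" for x
  proof (rule linearI)
    show "g x (a + b) = g x a + g x b" for a b
      by (simp add: g_def linear_add[OF lin] scaleR_add_left sum.distrib)
    show "g x (c *\<^sub>R a) = c *\<^sub>R g x a" for a c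
      by (simp add: g_def linear_scale[OF lin] scaleR_add_right scaleR_sum_right)
  qed
  have N: "matrix (g x) *v v = g x v" for x v by (rule matrix_works) (use g in \<open>simp add: linear_matrix_vector_mul_eq\<close>)
  have gs: "g x (s i x0) = s i x" if "i < k" for x i
  proof -
    have "(\<Sum>j<k. f j (s i x0) *\<^sub>R (s j x - s j x0)) = (\<Sum>j<k. if j = i then s j x - s j x0 else 0)"
      by (rule sum.cong) (auto simp: f that)
    then show ?thesis using that by (simp add: g_def)
  qed
  show ?thesis
  proof (rule that[of "\<lambda>x. matrix (g x)"])
    show "smooth_on S (\<lambda>x. matrix (g x) $ i $ j)" for i j
      unfolding matrix_def g_def
      by (simp, intro smooth_on_add[OF S] smooth_on_const smooth_on_sum[OF S] smooth_on_mult[OF S]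
          smooth_on_diff[OF S] smooth_on_nth[OF S] sm) auto
    show "matrix (g x0) = mat 1" by (simp add: vec_eq_iff matrix_def g_def mat_def axis_def)
    show "(*v) (matrix (g x)) ` D x0 = D x" if "x \<in> S" for x
    proof -
      have "(*v) (matrix (g x)) ` D x0 = g x ` span ((\<lambda>j. s j x0) ` {..<k})"
        by (simp add: N span[OF x0])
      also have "\<dots> = span (g x ` (\<lambda>j. s j x0) ` {..<k})" by (rule linear_span_image[OF g, symmetric])
      also have "g x ` (\<lambda>j. s j x0) ` {..<k} = (\<lambda>j. s j x) ` {..<k}"
        by (auto simp: image_image gs)
      finally show ?thesis by (simp add: span[OF that])
    qed
  qed
qed

lemma finite_basis_gt:
  assumes "module.subspace cscale (V :: ((complex^'n::finite) \<times> (complex^'n)) set)"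
  obtains k :: nat and b where "inj_on b {..<k}" "\<not> module.dependent cscale (b ` {..<k})"
    "module.span cscale (b ` {..<k}) = V"
proof -
  interpret fd: finite_dimensional_vector_space_prod
    "(*s) :: complex \<Rightarrow> complex^'n \<Rightarrow> _" "(*s) :: complex \<Rightarrow> complex^'n \<Rightarrow> _" cart_basis cart_basis
    by unfold_locales
  obtain B where B: "B \<subseteq> V" "gt_space.p.independent B" "V \<subseteq> gt_space.p.span B"
    using gt_space.p.maximal_independent_subset[of V] by metis
  have "finite B" using fd.p.finiteI_independent B(2) by (simp add: cscale_eq)
  then obtain b where b: "bij_betw b {..<card B} B"
    using ex_bij_betw_nat_finite[of B] atLeast0LessThan by metis
  have "gt_space.p.span B = V"
    using B assms unfolding cscale_eq by (meson order_antisym gt_space.p.span_minimal)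
  then show ?thesis
    using that[of b "card B"] b B(2) unfolding cscale_eq bij_betw_def by simp
qed

text \<open>\<open>T\<close> is the set where the transport matrices, \<open>M\<close> for the
  ranges and \<open>C\<close> for the cores, are invertible. The last three conclusions serve, in
  turn, to lift sections of E smoothly, to extend a core vector to a section against which brackets
  are tested, and to give a frame of the fibres by transporting a basis at
  \<open>x0\<close>.\<close>

lemma qr_graph_local_structure:
  fixes P :: "real^'n::finite \<Rightarrow> complex^'n^'n" and s :: "nat \<Rightarrow> real^'n \<Rightarrow> real^'n"
  assumes S: "open S" and x0: "x0 \<in> S" and P: "\<And>i j. smooth_on S (\<lambda>x. P x $ i $ j)"
    and skew: "\<And>x. x \<in> S \<Longrightarrow> transpose (P x) = - P x"
    and dim: "\<And>x. x \<in> S \<Longrightarrow> vec.dim (range ((*v) (P x))) = vec.dim (range ((*v) (P x0)))"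
    and sm: "\<And>j. j < k \<Longrightarrow> smooth_on S (s j)"
    and inj: "inj_on (\<lambda>j. s j x0) {..<k}" and ind: "independent ((\<lambda>j. s j x0) ` {..<k})"
    and span: "\<And>x. x \<in> S \<Longrightarrow> span ((\<lambda>j. s j x) ` {..<k}) = {v. cvec v \<in> range ((*v) (P x))}"
  obtains T where "open T" "x0 \<in> T" "T \<subseteq> S"
    "\<And>X. smooth_on T X \<Longrightarrow> (\<And>x. x \<in> T \<Longrightarrow> X x \<in> range ((*v) (P x))) \<Longrightarrow>
      \<exists>\<alpha>. smooth_on T \<alpha> \<and> (\<forall>x\<in>T. X x = P x *v \<alpha> x)"
    "\<And>Z0. Z0 \<in> real_core (P x0) \<Longrightarrow> \<exists>Z. smooth_on T Z \<and> Z x0 = Z0 \<and> (\<forall>x\<in>T. Z x \<in> real_core (P x))"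
    "\<exists>(m::nat) b. (\<forall>i<m. smooth_on T (b i)) \<and> (\<forall>x\<in>T. inj_on (\<lambda>i. b i x) {..<m} \<and>
       \<not> module.dependent cscale ((\<lambda>i. b i x) ` {..<m}) \<and>
       module.span cscale ((\<lambda>i. b i x) ` {..<m}) = qr_graph (P x))"
proof -
  obtain R where R: "\<And>v. v \<in> range ((*v) (P x0)) \<Longrightarrow> P x0 *v (R *v v) = v"
    using generalized_inverse by blast
  obtain N where N: "\<And>i j. smooth_on S (\<lambda>x. N x $ i $ j)" and N0: "N x0 = mat 1"
    and ND: "\<And>x. x \<in> S \<Longrightarrow> (*v) (N x) ` {v. cvec v \<in> range ((*v) (P x0))} = {v. cvec v \<in> range ((*v) (P x))}"
    by (rule frame_transport[where D = "\<lambda>x. {v. cvec v \<in> range ((*v) (P x))}", OF S x0 sm inj ind span])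
       (assumption | rule that)+
  define M where "M x = range_transport (P x0) R (P x)" for x
  define C where "C x = cmat (N x)" for x
  have Msm: "smooth_on S (\<lambda>x. M x $ i $ j)" for i j
    unfolding M_def range_transport_def matrix_matrix_mult_def
    by (simp, intro smooth_on_add[OF S] smooth_on_const smooth_on_sum[OF S] smooth_on_mult[OF S]
        smooth_on_diff[OF S] P)
  have Csm: "smooth_on S (\<lambda>x. C x $ i $ j)" for i j
    unfolding C_def cmat_def nth_map_matrix
    by (rule smooth_on_bounded_linear[OF bounded_linear_of_real S N])
  \<comment> \<open>Both matrices are the identity at \<open>x0\<close>, so this open set contains
    \<open>x0\<close>.\<close>
  define T where "T = {x\<in>S. det (M x) \<noteq> 0} \<inter> {x\<in>S. det (C x) \<noteq> 0}"
  have T: "open T"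
    unfolding T_def
    using continuous_open_preimage[OF smooth_on_imp_continuous_on[OF smooth_on_det[OF S Msm]] S, of "- {0}"]
      continuous_open_preimage[OF smooth_on_imp_continuous_on[OF smooth_on_det[OF S Csm]] S, of "- {0}"]
    by (intro open_Int) (simp_all add: vimage_def Int_def open_Compl)
  have TS: "T \<subseteq> S" by (auto simp: T_def)
  have x0T: "x0 \<in> T" by (simp add: T_def x0 M_def C_def N0 range_transport_def)
  have detM: "det (M x) \<noteq> 0" and detC: "det (C x) \<noteq> 0" if "x \<in> T" for x
    using that by (simp_all add: T_def)
  have MT: "smooth_on T (\<lambda>x. M x $ i $ j)" and CT: "smooth_on T (\<lambda>x. C x $ i $ j)" for i j
    using smooth_on_subset TS Msm Csm by blast+
  have detCT: "det (transpose (C x)) \<noteq> 0" if "x \<in> T" for x using detC[OF that] by simp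
  have CTT: "smooth_on T (\<lambda>x. transpose (C x) $ i $ j)" for i j
    using CT by (simp add: transpose_def)
  note sR = smooth_on_matrix_vector[OF T smooth_on_const, of _ R]
    and sM = smooth_on_matrix_inv[OF T MT _ detM]
    and sC = smooth_on_matrix_vector[OF T CT]
    and sCT = smooth_on_matrix_inv[OF T CTT _ detCT]
  have lift: "P x *v (R *v (matrix_inv (M x) *v X)) = X" if "x \<in> T" "X \<in> range ((*v) (P x))" for x X
    unfolding M_def using that TS detM[of x]
    by (intro lift_along_range R dim) (auto simp: M_def)
  have core: "(*v) (C x) ` real_core (P x0) = real_core (P x)" if "x \<in> T" for x
    unfolding C_def by (rule core_transport) (use ND TS that in blast)
  show ?thesis
  proof (rule that[OF T x0T TS])
    fix X assume X: "smooth_on T X" "\<And>x. x \<in> T \<Longrightarrow> X x \<in> range ((*v) (P x))"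
    show "\<exists>\<alpha>. smooth_on T \<alpha> \<and> (\<forall>x\<in>T. X x = P x *v \<alpha> x)"
    proof (intro exI[of _ "\<lambda>x. R *v (matrix_inv (M x) *v X x)"] conjI ballI)
      show "smooth_on T (\<lambda>x. R *v (matrix_inv (M x) *v X x))" by (rule sR, rule sM, rule X)
      show "X x = P x *v (R *v (matrix_inv (M x) *v X x))" if "x \<in> T" for x
        by (rule lift[OF that X(2)[OF that], symmetric])
    qed
  next
    fix Z0 assume Z0: "Z0 \<in> real_core (P x0)"
    then show "\<exists>Z. smooth_on T Z \<and> Z x0 = Z0 \<and> (\<forall>x\<in>T. Z x \<in> real_core (P x))"
    proof (intro exI[of _ "\<lambda>x. C x *v Z0"] conjI ballI)
      show "smooth_on T (\<lambda>x. C x *v Z0)" by (rule sC, rule smooth_on_const)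
      show "C x0 *v Z0 = Z0" by (simp add: C_def N0)
      show "C x *v Z0 \<in> real_core (P x)" if "x \<in> T" for x using core[OF that] Z0 by blast
    qed
  next
    obtain m :: nat and b where b: "inj_on b {..<m}" "\<not> module.dependent cscale (b ` {..<m})"
      "module.span cscale (b ` {..<m}) = qr_graph (P x0)"
      by (rule finite_basis_gt[OF conjunct1[OF lagrangian_qr_graph[OF skew[OF x0], unfolded lagrangian_def]]])
         (assumption | rule that)+
    let ?b = "\<lambda>i x. qr_transport R (M x) (C x) (b i)"
    have "smooth_on T (?b i)" for i
      unfolding qr_transport_def
    proof (rule smooth_on_Pair[OF T _ smooth_on_add[OF T]])
      show C1: "smooth_on T (\<lambda>x. C x *v fst (b i))" by (rule sC, rule smooth_on_const)
      show "smooth_on T (\<lambda>x. R *v (matrix_inv (M x) *v (C x *v fst (b i))))"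
        by (rule sR, rule sM, rule C1)
      show "smooth_on T (\<lambda>x. matrix_inv (transpose (C x)) *v (snd (b i) - R *v fst (b i)))"
        by (rule sCT, rule smooth_on_const)
    qed
    moreover have "inj_on (\<lambda>i. ?b i x) {..<m} \<and>
       \<not> module.dependent cscale ((\<lambda>i. ?b i x) ` {..<m}) \<and>
       module.span cscale ((\<lambda>i. ?b i x) ` {..<m}) = qr_graph (P x)" if x: "x \<in> T" for x
    proof -
      interpret l: Vector_Spaces.linear cscale cscale "qr_transport R (M x) (C x)"
        by (rule qr_transport_linear)
      have q: "inj (qr_transport R (M x) (C x))" "qr_transport R (M x) (C x) ` qr_graph (P x0) = qr_graph (P x)"
        using qr_transport_image[OF R lift[OF x] core[OF x] detC[OF x] skew skew] x TS x0 by blast+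
      have im: "(\<lambda>i. ?b i x) ` {..<m} = qr_transport R (M x) (C x) ` b ` {..<m}" by auto
      have "inj_on (\<lambda>i. ?b i x) {..<m}"
        using b(1) q(1) by (meson inj_on_def injD)
      moreover have "\<not> module.dependent cscale ((\<lambda>i. ?b i x) ` {..<m})"
        unfolding im using b(2) q(1)
        by (intro l.independent_injective_image) (auto intro: inj_on_subset)
      moreover have "module.span cscale ((\<lambda>i. ?b i x) ` {..<m}) = qr_graph (P x)"
        unfolding im l.span_image b(3) q(2) ..
      ultimately show ?thesis by blast
    qed
    ultimately show "\<exists>(m::nat) b. (\<forall>i<m. smooth_on T (b i)) \<and> (\<forall>x\<in>T. inj_on (\<lambda>i. b i x) {..<m} \<and>
       \<not> module.dependent cscale ((\<lambda>i. b i x) ` {..<m}) \<and>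
       module.span cscale ((\<lambda>i. b i x) ` {..<m}) = qr_graph (P x))"
      by (intro exI[of _ m] exI[of _ ?b]) blast
  qed
qed

section \<open>Brackets in coordinates\<close>

lemma pd_has_derivative:
  "(f has_derivative f') (at x) \<Longrightarrow> pd i f x = f' (axis i 1)"
  unfolding pd_def by (metis frechet_derivative_at)

lemma pd_diff:
  "f differentiable at x \<Longrightarrow> g differentiable at x \<Longrightarrow> pd i (\<lambda>y. f y - g y) x = pd i f x - pd i g x"
  by (subst pd_has_derivative[OF has_derivative_diff[where f' = "frechet_derivative f (at x)" and g' = "frechet_derivative g (at x)"]])
     (simp_all add: frechet_derivative_works pd_def)

lemma pd_mult:
  "f differentiable at x \<Longrightarrow> g differentiable at x \<Longrightarrow>
    pd i (\<lambda>y. f y * g y) x = pd i f x * g x + f x * pd i g x"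
  by (subst pd_has_derivative[OF has_derivative_mult[where f' = "frechet_derivative f (at x)" and g' = "frechet_derivative g (at x)"]])
     (simp_all add: frechet_derivative_works pd_def)

lemma pd_sum:
  "(\<And>j. j \<in> J \<Longrightarrow> f j differentiable at x) \<Longrightarrow> pd i (\<lambda>y. \<Sum>j\<in>J. f j y) x = (\<Sum>j\<in>J. pd i (f j) x)"
  by (subst pd_has_derivative[OF has_derivative_sum[where f' = "\<lambda>j. frechet_derivative (f j) (at x)"]])
     (simp_all add: frechet_derivative_works pd_def)

lemma pd_cnj: "f differentiable at x \<Longrightarrow> pd i (\<lambda>y. cnj (f y)) x = cnj (pd i f x)"
  by (subst pd_has_derivative[OF bounded_linear.has_derivative[OF bounded_linear_cnj]])
     (simp_all add: frechet_derivative_works pd_def)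

lemma pd_cong:
  assumes "open T" "x \<in> T" "\<And>y. y \<in> T \<Longrightarrow> f y = g y" "f differentiable at x"
  shows "pd i f x = pd i g x"
  unfolding pd_def using frechet_derivative_transform_within_open[OF assms(4,1,2,3)] by simp

lemma smooth_on_nth_differentiable:
  "open T \<Longrightarrow> x \<in> T \<Longrightarrow> smooth_on T f \<Longrightarrow> (\<lambda>y. f y $ k) differentiable (at x)"
  by (rule smooth_on_imp_differentiable[OF smooth_on_nth])

lemma pd_scalar_product:
  assumes "open T" "x \<in> T" "smooth_on T f" "smooth_on T g"
  shows "pd i (\<lambda>y. scalar_product (f y) (g y)) x =
    (\<Sum>k\<in>UNIV. pd i (\<lambda>y. f y $ k) x * g x $ k + f x $ k * pd i (\<lambda>y. g y $ k) x)"
proof -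
  note d = smooth_on_nth_differentiable[OF assms(1,2,3)] smooth_on_nth_differentiable[OF assms(1,2,4)]
  show ?thesis
    unfolding scalar_product_def
    by (subst pd_sum) (auto intro!: differentiable_mult d simp: pd_mult[OF d])
qed

lemma pd_scalar_product_0:
  assumes "open T" "x \<in> T" "smooth_on T f" "smooth_on T g"
    and 0: "\<And>y. y \<in> T \<Longrightarrow> scalar_product (f y) (g y) = 0"
  shows "(\<Sum>k\<in>UNIV. pd i (\<lambda>y. f y $ k) x * g x $ k + f x $ k * pd i (\<lambda>y. g y $ k) x) = 0"
proof -
  have "pd i (\<lambda>y. scalar_product (f y) (g y)) x = pd i (\<lambda>y. 0) x"
    by (rule pd_cong[OF assms(1,2), symmetric]) (simp_all add: 0)
  then show ?thesis using pd_scalar_product[OF assms(1-4)] by (simp add: pd_def)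
qed

section \<open>Index identities behind the brackets, at a single point\<close>

text \<open>\<open>p\<close> stands for a bivector, \<open>D l i j\<close> for the derivative of its
  entry i, j in direction l; in \<open>da\<close>, \<open>db\<close>, \<open>dX\<close>,
  \<open>dY\<close> the direction also comes first. The claim is that [X, Y] is the image under p of
  the Lie derivative of b along X minus the contraction of Y with the exterior derivative of a.
  Derivatives of \<open>a\<close> and \<open>b\<close> match by exchanging sums and skewness; the
  terms with \<open>D\<close> cancel by the Jacobi identity \<open>J\<close>.\<close>

lemma schouten_cancellation:
  fixes p :: "'n::finite \<Rightarrow> 'n \<Rightarrow> complex" and D :: "'n \<Rightarrow> 'n \<Rightarrow> 'n \<Rightarrow> complex"
  assumes p: "\<And>i j. p i j = - p j i" and D: "\<And>l i j. D l i j = - D l j i"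
    and J: "\<And>i j k. (\<Sum>l\<in>UNIV. p i l * D l j k) + (\<Sum>l\<in>UNIV. p j l * D l k i) + (\<Sum>l\<in>UNIV. p k l * D l i j) = 0"
    and X: "\<And>i. X i = (\<Sum>l\<in>UNIV. p i l * a l)" and Y: "\<And>i. Y i = (\<Sum>l\<in>UNIV. p i l * b l)"
    and dX: "\<And>i k. dX i k = (\<Sum>l\<in>UNIV. D i k l * a l + p k l * da i l)"
    and dY: "\<And>i k. dY i k = (\<Sum>l\<in>UNIV. D i k l * b l + p k l * db i l)"
  shows "(\<Sum>i\<in>UNIV. X i * dY i k - Y i * dX i k) =
    (\<Sum>l\<in>UNIV. p k l * ((\<Sum>i\<in>UNIV. X i * db i l + b i * dX l i) - (\<Sum>i\<in>UNIV. Y i * (da i l - da l i))))"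
proof -
  have T1: "(\<Sum>i\<in>UNIV. X i * (\<Sum>l\<in>UNIV. p k l * db i l)) = (\<Sum>l\<in>UNIV. p k l * (\<Sum>i\<in>UNIV. X i * db i l))"
    by (simp add: sum_distrib_left mult.left_commute) (rule sum.swap)
  have T2: "(\<Sum>i\<in>UNIV. Y i * (\<Sum>l\<in>UNIV. p k l * da i l)) = (\<Sum>l\<in>UNIV. p k l * (\<Sum>i\<in>UNIV. Y i * da i l))"
    by (simp add: sum_distrib_left mult.left_commute) (rule sum.swap)
  \<comment> \<open>Skewness turns p contracted with b into -Y, so this part of the Lie derivative
    cancels the \<open>da l i\<close> half of the exterior derivative.\<close>
  have "(\<Sum>i\<in>UNIV. b i * (\<Sum>m\<in>UNIV. p i m * da l m)) = (\<Sum>m\<in>UNIV. (\<Sum>i\<in>UNIV. p i m * b i) * da l m)" for l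
    by (simp add: sum_distrib_left sum_distrib_right mult_ac) (rule sum.swap)
  also have "\<dots> l = - (\<Sum>m\<in>UNIV. Y m * da l m)" for l
    unfolding Y by (subst p) (simp add: sum_negf)
  finally have T3: "(\<Sum>i\<in>UNIV. b i * (\<Sum>m\<in>UNIV. p i m * da l m)) = - (\<Sum>m\<in>UNIV. Y m * da l m)" for l .
  \<comment> \<open>The three sums containing \<open>D\<close> are rewritten with the common factors
    \<open>a m * b l\<close>, so that they can be compared coefficient by coefficient.\<close>
  have T4a: "(\<Sum>i\<in>UNIV. X i * (\<Sum>l\<in>UNIV. D i k l * b l)) = (\<Sum>m\<in>UNIV. \<Sum>l\<in>UNIV. \<Sum>i\<in>UNIV. a m * b l * (p i m * D i k l))"
    (is "?L = _")
  proof -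
    have "?L = (\<Sum>i\<in>UNIV. \<Sum>m\<in>UNIV. \<Sum>l\<in>UNIV. a m * b l * (p i m * D i k l))"
      by (simp add: X sum_product mult_ac)
    also have "\<dots> = (\<Sum>m\<in>UNIV. \<Sum>i\<in>UNIV. \<Sum>l\<in>UNIV. a m * b l * (p i m * D i k l))" by (rule sum.swap)
    also have "\<dots> = (\<Sum>m\<in>UNIV. \<Sum>l\<in>UNIV. \<Sum>i\<in>UNIV. a m * b l * (p i m * D i k l))"
      by (rule sum.cong[OF refl], rule sum.swap)
    finally show ?thesis .
  qed
  have T4b: "(\<Sum>i\<in>UNIV. Y i * (\<Sum>m\<in>UNIV. D i k m * a m)) = (\<Sum>m\<in>UNIV. \<Sum>l\<in>UNIV. \<Sum>i\<in>UNIV. a m * b l * (p i l * D i k m))"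
    (is "?L = _")
  proof -
    have "?L = (\<Sum>i\<in>UNIV. \<Sum>l\<in>UNIV. \<Sum>m\<in>UNIV. a m * b l * (p i l * D i k m))"
      by (simp add: Y sum_product mult_ac)
    also have "\<dots> = (\<Sum>i\<in>UNIV. \<Sum>m\<in>UNIV. \<Sum>l\<in>UNIV. a m * b l * (p i l * D i k m))"
      by (rule sum.cong[OF refl], rule sum.swap)
    also have "\<dots> = (\<Sum>m\<in>UNIV. \<Sum>i\<in>UNIV. \<Sum>l\<in>UNIV. a m * b l * (p i l * D i k m))" by (rule sum.swap)
    also have "\<dots> = (\<Sum>m\<in>UNIV. \<Sum>l\<in>UNIV. \<Sum>i\<in>UNIV. a m * b l * (p i l * D i k m))"
      by (rule sum.cong[OF refl], rule sum.swap)
    finally show ?thesis .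
  qed
  have T4c: "(\<Sum>i\<in>UNIV. p k i * (\<Sum>l\<in>UNIV. b l * (\<Sum>m\<in>UNIV. D i l m * a m))) =
      (\<Sum>m\<in>UNIV. \<Sum>l\<in>UNIV. \<Sum>i\<in>UNIV. a m * b l * (p k i * D i l m))" (is "?L = _")
  proof -
    have "?L = (\<Sum>i\<in>UNIV. \<Sum>l\<in>UNIV. \<Sum>m\<in>UNIV. a m * b l * (p k i * D i l m))"
      by (simp add: sum_distrib_left mult_ac)
    also have "\<dots> = (\<Sum>i\<in>UNIV. \<Sum>m\<in>UNIV. \<Sum>l\<in>UNIV. a m * b l * (p k i * D i l m))"
      by (rule sum.cong[OF refl], rule sum.swap)
    also have "\<dots> = (\<Sum>m\<in>UNIV. \<Sum>i\<in>UNIV. \<Sum>l\<in>UNIV. a m * b l * (p k i * D i l m))" by (rule sum.swap)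
    also have "\<dots> = (\<Sum>m\<in>UNIV. \<Sum>l\<in>UNIV. \<Sum>i\<in>UNIV. a m * b l * (p k i * D i l m))"
      by (rule sum.cong[OF refl], rule sum.swap)
    finally show ?thesis .
  qed
  \<comment> \<open>The Jacobi identity at m, k, l, with indices lined up by skewness of
    \<open>p\<close> and \<open>D\<close>.\<close>
  have cyc: "(\<Sum>i\<in>UNIV. p i m * D i k l) - (\<Sum>i\<in>UNIV. p i l * D i k m) = (\<Sum>i\<in>UNIV. p k i * D i l m)" for m l
  proof -
    have "(\<Sum>i\<in>UNIV. p i m * D i k l) = - (\<Sum>i\<in>UNIV. p m i * D i k l)"
      by (subst p) (simp add: sum_negf)
    moreover have "(\<Sum>i\<in>UNIV. p i l * D i k m) = (\<Sum>i\<in>UNIV. p l i * D i m k)"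
      by (subst p, subst D) simp
    ultimately show ?thesis using J[of m k l] by algebra
  qed
  have T4: "(\<Sum>i\<in>UNIV. X i * (\<Sum>l\<in>UNIV. D i k l * b l)) - (\<Sum>i\<in>UNIV. Y i * (\<Sum>m\<in>UNIV. D i k m * a m)) =
      (\<Sum>i\<in>UNIV. p k i * (\<Sum>l\<in>UNIV. b l * (\<Sum>m\<in>UNIV. D i l m * a m)))"
    unfolding T4a T4b T4c by (simp add: sum_subtractf[symmetric] sum_distrib_left[symmetric] right_diff_distrib[symmetric])
      (simp add: sum_subtractf cyc)
  have L: "(\<Sum>i\<in>UNIV. X i * dY i k - Y i * dX i k) =
     ((\<Sum>i\<in>UNIV. X i * (\<Sum>l\<in>UNIV. D i k l * b l)) - (\<Sum>i\<in>UNIV. Y i * (\<Sum>m\<in>UNIV. D i k m * a m)))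
     + (\<Sum>i\<in>UNIV. X i * (\<Sum>l\<in>UNIV. p k l * db i l)) - (\<Sum>i\<in>UNIV. Y i * (\<Sum>l\<in>UNIV. p k l * da i l))"
    by (simp add: dX dY sum.distrib sum_subtractf distrib_left)
  have Rl: "(\<Sum>i\<in>UNIV. X i * db i l + b i * dX l i) - (\<Sum>i\<in>UNIV. Y i * (da i l - da l i)) =
     (\<Sum>i\<in>UNIV. X i * db i l) + (\<Sum>i\<in>UNIV. b i * (\<Sum>m\<in>UNIV. D l i m * a m)) - (\<Sum>i\<in>UNIV. Y i * da i l)" for l
    using T3[of l] by (simp add: dX sum.distrib sum_subtractf distrib_left right_diff_distrib)
  show ?thesis
    unfolding L Rl T1 T2 T4 by (simp add: distrib_left right_diff_distrib sum.distrib sum_subtractf)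
qed

text \<open>This is (L_X \<phi>)(Z) = X(\<phi>(Z)) - \<phi>([X, Z]): the hypotheses say that
  \<phi>(Z) has vanishing derivatives and that \<phi> kills [X, Z].\<close>

lemma lie_deriv_cancellation:
  fixes X :: "'n::finite \<Rightarrow> complex"
  assumes 1: "\<And>i. (\<Sum>k\<in>UNIV. d\<phi> i k * Z k + \<phi> k * dZ i k) = 0"
    and 2: "(\<Sum>k\<in>UNIV. \<phi> k * (\<Sum>i\<in>UNIV. X i * dZ i k - Z i * dX i k)) = 0"
  shows "(\<Sum>k\<in>UNIV. (\<Sum>i\<in>UNIV. X i * d\<phi> i k + \<phi> i * dX k i) * Z k) = 0"
proof -
  have "(\<Sum>k\<in>UNIV. (\<Sum>i\<in>UNIV. X i * d\<phi> i k + \<phi> i * dX k i) * Z k) =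
     (\<Sum>k\<in>UNIV. \<Sum>i\<in>UNIV. X i * (d\<phi> i k * Z k)) + (\<Sum>k\<in>UNIV. \<Sum>i\<in>UNIV. \<phi> i * (Z k * dX k i))"
    by (simp only: sum_distrib_right sum.distrib distrib_right) (simp add: mult_ac)
  also have "(\<Sum>k\<in>UNIV. \<Sum>i\<in>UNIV. X i * (d\<phi> i k * Z k)) = (\<Sum>i\<in>UNIV. X i * (\<Sum>k\<in>UNIV. d\<phi> i k * Z k))"
    by (subst sum.swap) (simp add: sum_distrib_left)
  also have "\<dots> = (\<Sum>i\<in>UNIV. X i * - (\<Sum>k\<in>UNIV. \<phi> k * dZ i k))"
    using 1 by (simp add: sum.distrib add_eq_0_iff2)
  also have "\<dots> = - (\<Sum>k\<in>UNIV. \<Sum>i\<in>UNIV. \<phi> k * (X i * dZ i k))"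
    by (subst sum.swap) (simp add: sum_distrib_left sum_negf mult_ac)
  also have "(\<Sum>k\<in>UNIV. \<Sum>i\<in>UNIV. \<phi> i * (Z k * dX k i)) = (\<Sum>k\<in>UNIV. \<Sum>i\<in>UNIV. \<phi> k * (Z i * dX i k))"
    by (rule sum.swap)
  finally show ?thesis
    using 2 by (simp add: sum_distrib_left right_diff_distrib sum_subtractf)
qed

text \<open>Contracting Y with d\<theta> gives L_Y \<theta> - d(\<theta>(Y)), which reduces the
  claim to the previous identity and the vanishing derivatives of \<theta>(Y).\<close>

lemma ext_deriv_cancellation:
  fixes Y :: "'n::finite \<Rightarrow> complex"
  assumes 1: "\<And>i. (\<Sum>k\<in>UNIV. d\<theta> i k * Z k + \<theta> k * dZ i k) = 0"
    and 2: "\<And>i. (\<Sum>k\<in>UNIV. d\<theta> i k * Y k + \<theta> k * dY i k) = 0"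
    and 3: "(\<Sum>k\<in>UNIV. \<theta> k * (\<Sum>i\<in>UNIV. Y i * dZ i k - Z i * dY i k)) = 0"
  shows "(\<Sum>k\<in>UNIV. (\<Sum>i\<in>UNIV. Y i * (d\<theta> i k - d\<theta> k i)) * Z k) = 0"
proof -
  have "(\<Sum>k\<in>UNIV. (\<Sum>i\<in>UNIV. Y i * (d\<theta> i k - d\<theta> k i)) * Z k) =
     (\<Sum>k\<in>UNIV. (\<Sum>i\<in>UNIV. Y i * d\<theta> i k + \<theta> i * dY k i) * Z k)
     - (\<Sum>k\<in>UNIV. Z k * (\<Sum>i\<in>UNIV. d\<theta> k i * Y i + \<theta> i * dY k i))"
    by (simp add: sum_distrib_right sum_distrib_left sum_subtractf sum.distrib algebra_simps)
  then show ?thesis using lie_deriv_cancellation[OF 1 3] 2 by simp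
qed

section \<open>Brackets of smooth sections in a chart\<close>

lemma lie_bracket_vcnj:
  assumes "open T" "x \<in> T" "smooth_on T X" "smooth_on T Y"
  shows "lie_bracket (\<lambda>y. vcnj (X y)) (\<lambda>y. vcnj (Y y)) x = vcnj (lie_bracket X Y x)"
proof -
  note d = smooth_on_nth_differentiable[OF assms(1,2,3)] smooth_on_nth_differentiable[OF assms(1,2,4)]
  show ?thesis by (simp add: lie_bracket_def vec_eq_iff pd_cnj[OF d(1)] pd_cnj[OF d(2)])
qed

lemma smooth_on_vcnj: "open T \<Longrightarrow> smooth_on T X \<Longrightarrow> smooth_on T (\<lambda>y. vcnj (X y))"
  by (rule smooth_on_vec, assumption, simp only: vcnj_nth)
     (rule smooth_on_bounded_linear[OF bounded_linear_cnj], assumption, rule smooth_on_nth)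

text \<open>The form component of the Courant-Dorfman bracket, with vectors and forms as separate
  arguments so that the forms can be exchanged while \<open>X\<close> and \<open>Y\<close> stay
  fixed.\<close>

definition form_part ::
  "(real^'n \<Rightarrow> complex^'n) \<Rightarrow> (real^'n \<Rightarrow> complex^'n) \<Rightarrow> (real^'n \<Rightarrow> complex^'n) \<Rightarrow> (real^'n \<Rightarrow> complex^'n) \<Rightarrow>
   real^'n \<Rightarrow> complex^'n::finite" where
  "form_part X \<xi> Y \<eta> x = lie_deriv_form X \<eta> x - contract (Y x) (ext_deriv_form \<xi> x)"

lemma form_part_nth:
  "form_part X \<xi> Y \<eta> x $ k =
    (\<Sum>i\<in>UNIV. X x $ i * pd i (\<lambda>y. \<eta> y $ k) x + \<eta> x $ i * pd k (\<lambda>y. X y $ i) x)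
    - (\<Sum>i\<in>UNIV. Y x $ i * (pd i (\<lambda>y. \<xi> y $ k) x - pd k (\<lambda>y. \<xi> y $ i) x))"
  by (simp add: form_part_def lie_deriv_form_def contract_def ext_deriv_form_def)

lemma form_part_diff:
  assumes T: "open T" "x \<in> T" and "smooth_on T \<xi>" "smooth_on T \<xi>'" "smooth_on T \<eta>" "smooth_on T \<eta>'"
  shows "form_part X \<xi> Y \<eta> x - form_part X \<xi>' Y \<eta>' x = form_part X (\<lambda>y. \<xi> y - \<xi>' y) Y (\<lambda>y. \<eta> y - \<eta>' y) x"
proof -
  note d = assms(3-6)[THEN smooth_on_nth_differentiable[OF T]]
  show ?thesis
    by (simp add: vec_eq_iff form_part_nth pd_diff[OF d(1,2)] pd_diff[OF d(3,4)]
        sum_subtractf sum.distrib algebra_simps)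
qed

text \<open>This is involutivity of the graph of a Poisson bivector. The relations X = P \<alpha>, Y
  = P \<beta> and the skewness of \<open>P\<close> are differentiated at \<open>x\<close>, and
  \<open>schouten_cancellation\<close> concludes.\<close>

lemma lie_bracket_sharp:
  fixes P :: "real^'n::finite \<Rightarrow> complex^'n^'n"
  assumes T: "open T" "x \<in> T" and P: "\<And>i j. smooth_on T (\<lambda>x. P x $ i $ j)"
    and skew: "\<And>x. x \<in> T \<Longrightarrow> transpose (P x) = - P x"
    and schouten: "\<And>i j k. schouten_coord P P x i j k = 0"
    and sm: "smooth_on T \<alpha>" "smooth_on T \<beta>" "smooth_on T X" "smooth_on T Y"
    and X: "\<And>x. x \<in> T \<Longrightarrow> X x = P x *v \<alpha> x" and Y: "\<And>x. x \<in> T \<Longrightarrow> Y x = P x *v \<beta> x"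
  shows "lie_bracket X Y x = P x *v form_part X \<alpha> Y \<beta> x"
proof -
  have sk: "P y $ i $ j = - P y $ j $ i" if "y \<in> T" for y i j
  proof -
    have "P y $ i $ j = transpose (P y) $ j $ i" by (simp add: transpose_def)
    also have "\<dots> = - P y $ j $ i" unfolding skew[OF that] by simp
    finally show ?thesis .
  qed
  have dP: "(\<lambda>y. P y $ i $ j) differentiable (at x)" for i j
    using smooth_on_imp_differentiable[OF P T(2)] .
  define D where "D l i j = pd l (\<lambda>y. P y $ i $ j) x" for l i j
  have Dsk: "D l i j = - D l j i" for l i j
  proof -
    have "D l i j = pd l (\<lambda>y. 0 - P y $ j $ i) x"
      unfolding D_def
    proof (rule pd_cong[OF T _ dP])
      show "P y $ i $ j = 0 - P y $ j $ i" if "y \<in> T" for y using sk[OF that, of i j] by (simp only: diff_0)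
    qed
    also have "\<dots> = pd l (\<lambda>y. 0) x - pd l (\<lambda>y. P y $ j $ i) x"
      by (rule pd_diff) (simp_all add: dP)
    finally show ?thesis by (simp add: D_def pd_def)
  qed
  have J: "(\<Sum>l\<in>UNIV. P x $ i $ l * D l j k) + (\<Sum>l\<in>UNIV. P x $ j $ l * D l k i)
      + (\<Sum>l\<in>UNIV. P x $ k $ l * D l i j) = 0" for i j k
  proof -
    let ?c = "(\<Sum>l\<in>UNIV. P x $ i $ l * D l j k) + (\<Sum>l\<in>UNIV. P x $ j $ l * D l k i)
      + (\<Sum>l\<in>UNIV. P x $ k $ l * D l i j)"
    \<comment> \<open>For equal arguments \<open>schouten_coord\<close> counts the cyclic sum
      twice.\<close>
    have "2 * ?c = 0"
      using schouten[of i j k] unfolding schouten_coord_def Let_def D_def[symmetric] by (simp add: algebra_simps)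
    moreover have "2 * c = 0 \<Longrightarrow> c = 0" for c :: complex by simp
    ultimately show ?thesis by blast
  qed
  have der: "pd i (\<lambda>y. W y $ k) x = (\<Sum>l\<in>UNIV. D i k l * \<omega> x $ l + P x $ k $ l * pd i (\<lambda>y. \<omega> y $ l) x)"
    if W: "\<And>x. x \<in> T \<Longrightarrow> W x = P x *v \<omega> x" and \<omega>: "smooth_on T \<omega>" and sW: "smooth_on T W" for W \<omega> i k
  proof -
    note d = smooth_on_nth_differentiable[OF T \<omega>]
    have "pd i (\<lambda>y. W y $ k) x = pd i (\<lambda>y. \<Sum>l\<in>UNIV. P y $ k $ l * \<omega> y $ l) x"
      by (rule pd_cong[OF T _ smooth_on_nth_differentiable[OF T sW]])
         (simp add: W matrix_vector_mult_def)
    also have "\<dots> = (\<Sum>l\<in>UNIV. pd i (\<lambda>y. P y $ k $ l * \<omega> y $ l) x)"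
      by (rule pd_sum) (intro differentiable_mult dP d)
    finally show ?thesis by (simp add: pd_mult[OF dP d] D_def)
  qed
  show ?thesis
    unfolding vec_eq_iff
  proof
    fix k
    have "(\<Sum>i\<in>UNIV. X x $ i * pd i (\<lambda>y. Y y $ k) x - Y x $ i * pd i (\<lambda>y. X y $ k) x) =
      (\<Sum>l\<in>UNIV. P x $ k $ l * form_part X \<alpha> Y \<beta> x $ l)"
      unfolding form_part_nth
    proof (rule schouten_cancellation[where p = "\<lambda>i j. P x $ i $ j" and D = D and a = "\<lambda>l. \<alpha> x $ l"
            and b = "\<lambda>l. \<beta> x $ l" and da = "\<lambda>i l. pd i (\<lambda>y. \<alpha> y $ l) x" and db = "\<lambda>i l. pd i (\<lambda>y. \<beta> y $ l) x"
            and X = "\<lambda>i. X x $ i" and Y = "\<lambda>i. Y x $ i" and dX = "\<lambda>i k. pd i (\<lambda>y. X y $ k) x"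
            and dY = "\<lambda>i k. pd i (\<lambda>y. Y y $ k) x"])
      show "X x $ i = (\<Sum>l\<in>UNIV. P x $ i $ l * \<alpha> x $ l)" "Y x $ i = (\<Sum>l\<in>UNIV. P x $ i $ l * \<beta> x $ l)" for i
        by (simp_all add: X[OF T(2)] Y[OF T(2)] matrix_vector_mult_def)
      show "pd i (\<lambda>y. X y $ k) x = (\<Sum>l\<in>UNIV. D i k l * \<alpha> x $ l + P x $ k $ l * pd i (\<lambda>y. \<alpha> y $ l) x)" for i k
        by (rule der[OF X sm(1,3)])
      show "pd i (\<lambda>y. Y y $ k) x = (\<Sum>l\<in>UNIV. D i k l * \<beta> x $ l + P x $ k $ l * pd i (\<lambda>y. \<beta> y $ l) x)" for i k
        by (rule der[OF Y sm(2,4)])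
    qed (rule sk[OF T(2)], rule Dsk, rule J)
    then show "lie_bracket X Y x $ k = (P x *v form_part X \<alpha> Y \<beta> x) $ k"
      by (simp add: lie_bracket_def matrix_vector_mult_def)
  qed
qed

text \<open>The form part is tested against a section \<open>Z\<close> of \<open>\<Delta>\<^sub>\<complex>\<close>; since these are closed under
  Lie brackets, it depends only on the restrictions of \<open>\<xi>\<close> and \<open>\<eta>\<close> to \<open>\<Delta>\<^sub>\<complex>\<close>, so both may be
  replaced by lifts of \<open>X\<close> and \<open>Y\<close> through \<open>P\<close>, where the Poisson condition applies.\<close>

lemma courant_coord_qr_graph:
  fixes P :: "real^'n::finite \<Rightarrow> complex^'n^'n"
  assumes T: "open T" "x0 \<in> T" and P: "\<And>i j. smooth_on T (\<lambda>x. P x $ i $ j)"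
    and skew: "\<And>x. x \<in> T \<Longrightarrow> transpose (P x) = - P x"
    and schouten: "\<And>i j k. schouten_coord P P x0 i j k = 0"
    and lift: "\<And>X. smooth_on T X \<Longrightarrow> (\<And>x. x \<in> T \<Longrightarrow> X x \<in> range ((*v) (P x))) \<Longrightarrow>
      \<exists>\<alpha>. smooth_on T \<alpha> \<and> (\<forall>x\<in>T. X x = P x *v \<alpha> x)"
    and ext: "\<And>Z0. Z0 \<in> real_core (P x0) \<Longrightarrow> \<exists>Z. smooth_on T Z \<and> Z x0 = Z0 \<and> (\<forall>x\<in>T. Z x \<in> real_core (P x))"
    and st: "smooth_on T s" "smooth_on T t"
    and qrl: "\<And>x. x \<in> T \<Longrightarrow> s x \<in> qr_graph (P x)" "\<And>x. x \<in> T \<Longrightarrow> t x \<in> qr_graph (P x)"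
  shows "courant_coord s t x0 \<in> qr_graph (P x0)"
proof -
  have lift': "\<exists>\<alpha>. smooth_on T \<alpha> \<and> (\<forall>x\<in>T. X x = P x *v \<alpha> x)"
    if "smooth_on T X" "\<And>x. x \<in> T \<Longrightarrow> X x \<in> real_core (P x)" for X
    using that by (intro lift) (auto simp: real_core_def)
  have range: "lie_bracket X Y x0 \<in> range ((*v) (P x0))"
    if sm: "smooth_on T X" "smooth_on T Y" and mem: "\<And>x. x \<in> T \<Longrightarrow> X x \<in> real_core (P x)" "\<And>x. x \<in> T \<Longrightarrow> Y x \<in> real_core (P x)"
    for X Y
  proof -
    obtain \<alpha> \<beta> where \<alpha>: "smooth_on T \<alpha>" "\<And>x. x \<in> T \<Longrightarrow> X x = P x *v \<alpha> x"
      and \<beta>: "smooth_on T \<beta>" "\<And>x. x \<in> T \<Longrightarrow> Y x = P x *v \<beta> x"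
      using lift'[OF sm(1) mem(1)] lift'[OF sm(2) mem(2)] by blast
    have "lie_bracket X Y x0 = P x0 *v form_part X \<alpha> Y \<beta> x0"
      by (rule lie_bracket_sharp[where P = P, OF T P skew schouten \<alpha>(1) \<beta>(1) sm \<alpha>(2) \<beta>(2)])
    then show ?thesis by simp
  qed
  \<comment> \<open>\<open>range\<close> is applied to the sections and to their conjugates, which
    again lie in the core; so the bracket and its conjugate both lie in E.\<close>
  have closed: "lie_bracket X Y x0 \<in> real_core (P x0)"
    if sm: "smooth_on T X" "smooth_on T Y" and mem: "\<And>x. x \<in> T \<Longrightarrow> X x \<in> real_core (P x)" "\<And>x. x \<in> T \<Longrightarrow> Y x \<in> real_core (P x)"
    for X Y
    using range[OF sm mem]
      range[OF smooth_on_vcnj[OF T(1) sm(1)] smooth_on_vcnj[OF T(1) sm(2)] core_vcnj[OF mem(1)] core_vcnj[OF mem(2)]]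
    by (simp add: real_core_def lie_bracket_vcnj[OF T sm])
  define X \<xi> Y \<eta> where defs: "X = fst \<circ> s" "\<xi> = snd \<circ> s" "Y = fst \<circ> t" "\<eta> = snd \<circ> t"
  have sm: "smooth_on T X" "smooth_on T \<xi>" "smooth_on T Y" "smooth_on T \<eta>"
    unfolding defs comp_def by (intro smooth_on_fst smooth_on_snd T st)+
  have mem: "(X x, \<xi> x) \<in> qr_graph (P x)" "(Y x, \<eta> x) \<in> qr_graph (P x)" if "x \<in> T" for x
    using qrl[OF that] by (simp_all add: defs)
  have XY: "X x \<in> real_core (P x)" "Y x \<in> real_core (P x)" if "x \<in> T" for x
    using mem[OF that] by (blast elim: qr_graphE)+
  obtain \<alpha> \<beta> where \<alpha>: "smooth_on T \<alpha>" "\<And>x. x \<in> T \<Longrightarrow> X x = P x *v \<alpha> x"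
    and \<beta>: "smooth_on T \<beta>" "\<And>x. x \<in> T \<Longrightarrow> Y x = P x *v \<beta> x"
    using lift'[OF sm(1) XY(1)] lift'[OF sm(3) XY(2)] by blast
  \<comment> \<open>The smooth lifts come from \<open>lift\<close>, not from membership in
    \<open>qr_graph\<close>; lifts of both kinds differ by an annihilator of E.\<close>
  have kill: "scalar_product (\<omega> - \<alpha>) Z = 0"
    if q: "(P x *v \<alpha>, \<omega>) \<in> qr_graph (P x)" and Z: "Z \<in> real_core (P x)" and x: "x \<in> T" for x \<omega> \<alpha> Z
  proof -
    obtain \<alpha>' where "P x *v \<alpha> = P x *v \<alpha>'" and *: "scalar_product (\<omega> - \<alpha>') Z = 0"
      using q Z by (blast elim: qr_graphE)
    then have "P x *v (\<alpha>' - \<alpha>) = 0" by (simp add: vec.diff)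
    then have "scalar_product (\<alpha>' - \<alpha>) Z = 0"
      using Z skew_kernel[OF skew[OF x]] unfolding real_core_def by blast
    then show ?thesis using * by simp
  qed
  let ?\<theta> = "\<lambda>y. \<xi> y - \<alpha> y" and ?\<phi> = "\<lambda>y. \<eta> y - \<beta> y"
  have s\<theta>: "smooth_on T ?\<theta>" and s\<phi>: "smooth_on T ?\<phi>"
    by (intro smooth_on_diff T sm \<alpha>(1) \<beta>(1))+
  have k: "scalar_product (?\<theta> x) Z = 0" "scalar_product (?\<phi> x) Z = 0" if "x \<in> T" "Z \<in> real_core (P x)" for x Z
    using kill[OF mem(1)[OF that(1), unfolded \<alpha>(2)[OF that(1)]] that(2,1)]
      kill[OF mem(2)[OF that(1), unfolded \<beta>(2)[OF that(1)]] that(2,1)] by simp_all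
  have "courant_coord s t x0 = (lie_bracket X Y x0, form_part X \<xi> Y \<eta> x0)"
    by (simp add: courant_coord_def Let_def defs form_part_def)
  moreover have "(lie_bracket X Y x0, form_part X \<xi> Y \<eta> x0) \<in> qr_graph (P x0)"
  proof (rule qr_graphI)
    show "lie_bracket X Y x0 = P x0 *v form_part X \<alpha> Y \<beta> x0"
      by (rule lie_bracket_sharp[where P = P, OF T P skew schouten \<alpha>(1) \<beta>(1) sm(1,3) \<alpha>(2) \<beta>(2)])
    show "lie_bracket X Y x0 \<in> real_core (P x0)"
      by (rule closed[OF sm(1,3) XY])
    fix Z0 assume "Z0 \<in> real_core (P x0)"
    then obtain Z where Z: "smooth_on T Z" "Z x0 = Z0" "\<And>x. x \<in> T \<Longrightarrow> Z x \<in> real_core (P x)"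
      using ext by blast
    \<comment> \<open>These pairings vanish identically on \<open>T\<close>, so their derivatives
      vanish at \<open>x0\<close>. The third one vanishes because \<open>Y\<close> is itself a
      section of the core.\<close>
    have \<phi>Z: "(\<Sum>k\<in>UNIV. pd i (\<lambda>y. ?\<phi> y $ k) x0 * Z x0 $ k + ?\<phi> x0 $ k * pd i (\<lambda>y. Z y $ k) x0) = 0"
      and \<theta>Z: "(\<Sum>k\<in>UNIV. pd i (\<lambda>y. ?\<theta> y $ k) x0 * Z x0 $ k + ?\<theta> x0 $ k * pd i (\<lambda>y. Z y $ k) x0) = 0"
      and \<theta>Y: "(\<Sum>k\<in>UNIV. pd i (\<lambda>y. ?\<theta> y $ k) x0 * Y x0 $ k + ?\<theta> x0 $ k * pd i (\<lambda>y. Y y $ k) x0) = 0" for i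
      by (rule pd_scalar_product_0[OF T]; use s\<theta> s\<phi> Z sm k XY in blast)+
    have \<phi>XZ: "(\<Sum>k\<in>UNIV. ?\<phi> x0 $ k * (\<Sum>i\<in>UNIV. X x0 $ i * pd i (\<lambda>y. Z y $ k) x0 - Z x0 $ i * pd i (\<lambda>y. X y $ k) x0)) = 0"
      using k(2)[OF T(2) closed[OF sm(1) Z(1) XY(1) Z(3)]]
      by (simp only: scalar_product_def lie_bracket_def vec_lambda_beta)
    have \<theta>YZ: "(\<Sum>k\<in>UNIV. ?\<theta> x0 $ k * (\<Sum>i\<in>UNIV. Y x0 $ i * pd i (\<lambda>y. Z y $ k) x0 - Z x0 $ i * pd i (\<lambda>y. Y y $ k) x0)) = 0"
      using k(1)[OF T(2) closed[OF sm(3) Z(1) XY(2) Z(3)]]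
      by (simp only: scalar_product_def lie_bracket_def vec_lambda_beta)
    \<comment> \<open>The form component is additive in the forms, so replacing \<xi>, \<eta> by
      \<alpha>, \<beta> costs the same expression in the differences; its Lie derivative and its
      contraction vanish on \<open>Z\<close> separately.\<close>
    have "scalar_product (form_part X ?\<theta> Y ?\<phi> x0) (Z x0) = 0"
      unfolding scalar_product_def form_part_nth left_diff_distrib sum_subtractf
        lie_deriv_cancellation[OF \<phi>Z \<phi>XZ] ext_deriv_cancellation[OF \<theta>Z \<theta>Y \<theta>YZ] by simp
    then show "scalar_product (form_part X \<xi> Y \<eta> x0 - form_part X \<alpha> Y \<beta> x0) Z0 = 0"
      unfolding form_part_diff[OF T sm(2) \<alpha>(1) sm(4) \<beta>(1)] Z(2) .
  qed
  ultimately show ?thesis by simp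
qed

section \<open>Passage to the manifold\<close>

lemma manifold_chart:
  assumes "smooth_manifold A" "c \<in> A"
  shows "open (fst c)" "open (snd c ` fst c)" "homeomorphism (fst c) (snd c ` fst c) (snd c) (chart_inv c)"
  using assms by (auto simp: smooth_manifold_def is_chart_def)

lemma chart_inv_cancel:
  assumes "smooth_manifold A" "c \<in> A"
  shows "q \<in> fst c \<Longrightarrow> chart_inv c (snd c q) = q"
  using manifold_chart(3)[OF assms] by (simp add: homeomorphism_def)

lemma chart_image_open:
  assumes "smooth_manifold A" "c \<in> A" "open U"
  shows "open (snd c ` (fst c \<inter> U))"
  using homeomorphism_imp_open_map[OF manifold_chart(3)[OF assms(1,2)], of "fst c \<inter> U"]
    manifold_chart(2)[OF assms(1,2)] assms(3)
  by (metis openin_open_Int openin_open_trans)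

lemma chart_preimage_open:
  assumes "smooth_manifold A" "c \<in> A" "open T"
  shows "open {q \<in> fst c. snd c q \<in> T}"
proof -
  have "continuous_on (fst c) (snd c)"
    using manifold_chart(3)[OF assms(1,2)] by (simp add: homeomorphism_def)
  from continuous_open_preimage[OF this manifold_chart(1)[OF assms(1,2)] assms(3)]
  show ?thesis by (simp add: vimage_def Int_def)
qed

lemma chart_at_mem:
  assumes "smooth_manifold A"
  shows "chart_at A p \<in> A" "p \<in> fst (chart_at A p)"
proof -
  have "\<exists>c. c \<in> A \<and> p \<in> fst c" using assms unfolding smooth_manifold_def by blast
  then have "chart_at A p \<in> A \<and> p \<in> fst (chart_at A p)"
    unfolding chart_at_def by (rule someI_ex)
  then show "chart_at A p \<in> A" "p \<in> fst (chart_at A p)" by auto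
qed

lemma transition_smooth:
  assumes "smooth_manifold A" "c \<in> A" "d \<in> A"
  shows "smooth_on (snd c ` (fst c \<inter> fst d)) (snd d \<circ> chart_inv c)"
  using assms unfolding smooth_manifold_def by blast

lemma transition_has_derivative:
  assumes "smooth_manifold A" "c \<in> A" "d \<in> A" "q \<in> fst c" "q \<in> fst d"
  shows "((snd d \<circ> chart_inv c) has_derivative (\<lambda>h. change_jac c d q *v h)) (at (snd c q))"
  unfolding change_jac_def jacobian_works[symmetric]
  by (rule smooth_on_imp_differentiable[OF transition_smooth[OF assms(1-3)]]) (use assms in blast)

text \<open>Chain rule for transition maps; the composite is known to be the third transition map
  only on an overlap, which is open.\<close>

lemma change_jac_trans:
  assumes A: "smooth_manifold A" "b \<in> A" "c \<in> A" "d \<in> A" and q: "q \<in> fst b" "q \<in> fst c" "q \<in> fst d"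
  shows "change_jac c d q ** change_jac b c q = change_jac b d q"
proof -
  have eq: "(snd c \<circ> chart_inv b) (snd b q) = snd c q"
    by (simp add: chart_inv_cancel[OF A(1,2) q(1)])
  have "((snd d \<circ> chart_inv c) \<circ> (snd c \<circ> chart_inv b) has_derivative
      (\<lambda>h. change_jac c d q *v h) \<circ> (\<lambda>h. change_jac b c q *v h)) (at (snd b q))"
    by (rule diff_chain_at[OF transition_has_derivative[OF A(1,2,3) q(1,2)]])
       (unfold eq, rule transition_has_derivative[OF A(1,3,4) q(2,3)])
  then have "(snd d \<circ> chart_inv b has_derivative
      (\<lambda>h. change_jac c d q *v h) \<circ> (\<lambda>h. change_jac b c q *v h)) (at (snd b q))"
  proof (rule has_derivative_transform_within_open)
    show "open (snd b ` (fst b \<inter> fst c))" by (rule chart_image_open[OF A(1,2) manifold_chart(1)[OF A(1,3)]])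
    show "snd b q \<in> snd b ` (fst b \<inter> fst c)" using q by blast
    fix x assume "x \<in> snd b ` (fst b \<inter> fst c)"
    then show "((snd d \<circ> chart_inv c) \<circ> (snd c \<circ> chart_inv b)) x = (snd d \<circ> chart_inv b) x"
      using chart_inv_cancel[OF A(1,2)] chart_inv_cancel[OF A(1,3)] by auto
  qed
  from has_derivative_unique[OF this transition_has_derivative[OF A(1,2,4) q(1,3)]]
  show ?thesis
    by (simp add: matrix_eq fun_eq_iff matrix_vector_mul_assoc)
qed

lemma change_jac_refl:
  assumes A: "smooth_manifold A" "c \<in> A" and q: "q \<in> fst c"
  shows "change_jac c c q = mat 1"
proof -
  have "((\<lambda>x. x) has_derivative (\<lambda>h. h)) (at (snd c q))" by (rule has_derivative_ident)
  then have "(snd c \<circ> chart_inv c has_derivative (\<lambda>h. h)) (at (snd c q))"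
  proof (rule has_derivative_transform_within_open)
    show "open (snd c ` fst c)" by (rule manifold_chart(2)[OF A])
    show "snd c q \<in> snd c ` fst c" using q by blast
    show "x = (snd c \<circ> chart_inv c) x" if "x \<in> snd c ` fst c" for x
      using that chart_inv_cancel[OF A] by auto
  qed
  from has_derivative_unique[OF this transition_has_derivative[OF A A(2) q q]]
  show ?thesis by (simp add: matrix_eq fun_eq_iff)
qed

lemma change_jac_inverse:
  assumes "smooth_manifold A" "c \<in> A" "d \<in> A" "q \<in> fst c" "q \<in> fst d"
  shows "change_jac d c q ** change_jac c d q = mat 1"
  using change_jac_trans[OF assms(1,2,3,2,4,5,4)] change_jac_refl[OF assms(1,2,4)] by simp

lemma local_rep_chart:
  assumes "smooth_manifold A" "c \<in> A" "q \<in> fst c"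
  shows "local_rep A act c s (snd c q) = act (change_jac (chart_at A q) c q) (s q)"
  by (simp add: local_rep_def Let_def chart_inv_cancel[OF assms])

text \<open>Values are stored in the chart chosen at each point, and this choice has no regularity.
  In a test chart \<open>d\<close> the cocycle rule removes the chosen chart and leaves only the
  smooth Jacobians between \<open>c\<close> and \<open>d\<close>.\<close>

lemma smooth_section_from_chart:
  fixes A :: "('a::{t2_space, second_countable_topology}, 'n::finite) chart set"
  assumes A: "smooth_manifold A" "c \<in> A" and U: "open U" "U \<subseteq> fst c"
    and \<sigma>: "smooth_on (snd c ` U) \<sigma>"
  shows "smooth_section A act_GTCM U (\<lambda>q. act_GTCM (change_jac c (chart_at A q) q) (\<sigma> (snd c q)))"
    (is "smooth_section A act_GTCM U ?s")
  unfolding smooth_section_def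
proof
  fix d assume d: "d \<in> A"
  let ?D = "snd d ` (fst d \<inter> U)" and ?\<tau> = "snd c \<circ> chart_inv d"
  have D: "open ?D" by (rule chart_image_open[OF A(1) d U(1)])
  have \<tau>: "smooth_on ?D ?\<tau>"
    by (rule smooth_on_subset[OF transition_smooth[OF A(1) d A(2)]]) (use U(2) in blast)
  have \<tau>D: "?\<tau> ` ?D \<subseteq> snd c ` U" "?\<tau> ` ?D \<subseteq> snd c ` (fst c \<inter> fst d)"
    using chart_inv_cancel[OF A(1) d] U(2) by auto
  have \<sigma>\<tau>: "smooth_on ?D (\<lambda>x. \<sigma> (?\<tau> x))"
    by (rule smooth_on_compose[OF D \<tau>D(1) \<sigma> \<tau>])
  have re: "smooth_on ?D (\<lambda>x. complex_of_real (f x $ i))" if "smooth_on ?D f" for f :: "real^'n \<Rightarrow> real^'n" and i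
    by (rule smooth_on_bounded_linear[OF bounded_linear_of_real D smooth_on_nth[OF D that]])
  have J: "smooth_on ?D (\<lambda>x. cmat (change_jac c d (chart_inv d x)) $ i $ j)" for i j
    unfolding cmat_def nth_map_matrix change_jac_def jacobian_def matrix_def vec_lambda_beta
    using re[OF smooth_on_compose[OF D \<tau>D(2) smooth_on_frechet_derivative[OF transition_smooth[OF A d]] \<tau>]]
    by (simp add: comp_def)
  \<comment> \<open>Covectors need the inverse Jacobian; as the Jacobian of the transition in the
    opposite direction it is the derivative of \<open>?\<tau>\<close> at x itself.\<close>
  have K: "smooth_on ?D (\<lambda>x. transpose (cmat (change_jac d c (chart_inv d x))) $ i $ j)" for i j
  proof (rule smooth_on_cong[OF D _ re[OF smooth_on_frechet_derivative[OF \<tau>, of "axis i 1"], of j]])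
    fix x assume "x \<in> ?D"
    then have "snd d (chart_inv d x) = x" using chart_inv_cancel[OF A(1) d] by auto
    then show "complex_of_real (frechet_derivative ?\<tau> (at x) (axis i 1) $ j) =
        transpose (cmat (change_jac d c (chart_inv d x))) $ i $ j"
      by (simp add: transpose_def cmat_def change_jac_def jacobian_def matrix_def)
  qed
  have "smooth_on ?D (\<lambda>x. (cmat (change_jac c d (chart_inv d x)) *v fst (\<sigma> (?\<tau> x)),
      transpose (cmat (change_jac d c (chart_inv d x))) *v snd (\<sigma> (?\<tau> x))))"
    by (intro smooth_on_Pair[OF D] smooth_on_matrix_vector[OF D] J K smooth_on_fst[OF D] smooth_on_snd[OF D] \<sigma>\<tau>)
  then show "smooth_on ?D (local_rep A act_GTCM d ?s)"
  proof (rule smooth_on_cong[OF D, rotated])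
    fix x assume "x \<in> ?D"
    then obtain q where q: "q \<in> fst d" "q \<in> U" "x = snd d q" by blast
    have qc: "q \<in> fst c" using q(2) U(2) by blast
    let ?e = "chart_at A q"
    note e = chart_at_mem[OF A(1), of q]
    note inv = change_jac_inverse[OF A(1)]
    have "local_rep A act_GTCM d ?s x =
        act_GTCM (change_jac ?e d q) (act_GTCM (change_jac c ?e q) (\<sigma> (snd c q)))"
      by (simp add: q(3) local_rep_chart[OF A(1) d q(1)])
    also have "\<dots> = act_GTCM (change_jac c d q) (\<sigma> (snd c q))"
      using act_GTCM_mult[OF inv[OF d e(1) q(1) e(2)] inv[OF e(1) d e(2) q(1)]
          inv[OF e(1) A(2) e(2) qc] inv[OF A(2) e(1) qc e(2)]]
        change_jac_trans[OF A e(1) d qc e(2) q(1)] by simp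
    also have "\<dots> = (cmat (change_jac c d q) *v fst (\<sigma> (snd c q)),
        transpose (cmat (change_jac d c q)) *v snd (\<sigma> (snd c q)))"
      using matrix_inv_eq[OF inv[OF d A(2) q(1) qc] inv[OF A(2) d qc q(1)]]
      by (simp add: act_GTCM_def act_TCM_def act_CotCM_def)
    finally show "(cmat (change_jac c d (chart_inv d x)) *v fst (\<sigma> (?\<tau> x)),
        transpose (cmat (change_jac d c (chart_inv d x))) *v snd (\<sigma> (?\<tau> x))) = local_rep A act_GTCM d ?s x"
      by (simp add: q(3) chart_inv_cancel[OF A(1) d q(1)])
  qed
qed

section \<open>Transport of fibres between charts, and local data of a strongly regular
  structure\<close>

lemma act_GTCM_linear: "Vector_Spaces.linear cscale cscale (act_GTCM J)"
proof -
  have "vector_space (cscale :: complex \<Rightarrow> (complex^'a) \<times> (complex^'a) \<Rightarrow> _)"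
    unfolding cscale_eq by (rule gt_space.p.vector_space_axioms)
  then show ?thesis
    by (intro Vector_Spaces.linear.intro module_hom.intro module_hom_axioms.intro)
       (auto simp: vector_space_def module_def act_GTCM_def act_TCM_def act_CotCM_def cscale_def vec.add vec.scale)
qed

lemma act_mat_1 [simp]:
  fixes P :: "complex^'n::finite^'n" and w :: "(complex^'n) \<times> (complex^'n)"
  shows "act_biv (mat 1) P = P" "act_GTCM (mat 1) w = w"
proof -
  have "matrix_inv (mat 1 :: real^'n^'n) = mat 1" by (rule matrix_inv_eq) simp_all
  then show "act_biv (mat 1) P = P" "act_GTCM (mat 1) w = w"
    by (simp_all add: act_biv_def act_GTCM_def act_TCM_def act_CotCM_def transpose_mat)
qed

lemma act_GTCM_inj:
  assumes "J ** J' = mat 1" "J' ** J = mat 1"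
  shows "inj (act_GTCM J)"
  by (rule inj_on_inverseI[where g = "act_GTCM J'"])
     (simp add: act_GTCM_mult[OF assms(2,1) assms, symmetric] assms(2))

lemma qr_graph_act_image:
  assumes J: "J ** J' = mat 1" "J' ** J = mat 1"
  shows "act_GTCM J ` qr_graph P = qr_graph (act_biv J P)"
proof (intro equalityI subsetI)
  fix v assume v: "v \<in> qr_graph (act_biv J P)"
  have "act_GTCM J' v \<in> qr_graph (act_biv J' (act_biv J P))" by (rule qr_graph_act[OF J(2,1) v])
  then have "act_GTCM J' v \<in> qr_graph P" by (simp add: act_biv_mult[symmetric] J)
  moreover have "v = act_GTCM J (act_GTCM J' v)"
    by (simp add: act_GTCM_mult[OF J J(2,1), symmetric] J)
  ultimately show "v \<in> act_GTCM J ` qr_graph P" by blast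
qed (use qr_graph_act[OF J] in blast)

lemma Delta_act:
  assumes J: "J ** J' = mat 1" "J' ** J = mat 1"
  shows "{v. cvec v \<in> range ((*v) (act_biv J P))} = (*v) J ` {v. cvec v \<in> range ((*v) P)}"
proof (intro equalityI subsetI)
  fix v assume "v \<in> {v. cvec v \<in> range ((*v) (act_biv J P))}"
  then obtain w where w: "w \<in> range ((*v) P)" "cvec v = cmat J *v w"
    unfolding range_act_biv[OF J] by blast
  have "w = cvec (J' *v v)"
    using arg_cong[OF w(2), of "(*v) (cmat J')"]
    by (simp add: cmat_cvec matrix_vector_mul_assoc cmat_mult[symmetric] J)
  moreover have "v = J *v (J' *v v)" by (simp add: matrix_vector_mul_assoc J)
  ultimately show "v \<in> (*v) J ` {v. cvec v \<in> range ((*v) P)}" using w(1) by blast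
next
  fix v assume "v \<in> (*v) J ` {v. cvec v \<in> range ((*v) P)}"
  then show "v \<in> {v. cvec v \<in> range ((*v) (act_biv J P))}"
    unfolding range_act_biv[OF J] by (auto simp: cmat_cvec[symmetric])
qed

text \<open>Both frames are used in the chart at \<open>p\<close>: the one of E shows that
  \<open>P\<close> has constant rank near \<open>p\<close>, the one of \<Delta> becomes a smooth
  real frame in coordinates. Then \<open>qr_graph_local_structure\<close> applies.\<close>

lemma strongly_regular_local:
  fixes A :: "('a::{t2_space, second_countable_topology}, 'n::finite) chart set"
  assumes A: "smooth_manifold A" and poisson: "complex_poisson A \<pi>" and reg: "strongly_regular A \<pi>"
    and V: "open V" "p \<in> V"
  defines "c \<equiv> chart_at A p"
  defines "P \<equiv> local_rep A act_biv c \<pi>"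
  obtains T where "open T" "snd c p \<in> T" "T \<subseteq> snd c ` (fst c \<inter> V)"
    "\<And>i j. smooth_on T (\<lambda>x. P x $ i $ j)"
    "\<forall>X. smooth_on T X \<longrightarrow> (\<forall>x\<in>T. X x \<in> range ((*v) (P x))) \<longrightarrow>
      (\<exists>\<alpha>. smooth_on T \<alpha> \<and> (\<forall>x\<in>T. X x = P x *v \<alpha> x))"
    "\<forall>Z0\<in>real_core (P (snd c p)).
      \<exists>Z. smooth_on T Z \<and> Z (snd c p) = Z0 \<and> (\<forall>x\<in>T. Z x \<in> real_core (P x))"
    "\<exists>(m::nat) b. (\<forall>i<m. smooth_on T (b i)) \<and> (\<forall>x\<in>T. inj_on (\<lambda>i. b i x) {..<m} \<and>
       \<not> module.dependent cscale ((\<lambda>i. b i x) ` {..<m}) \<and>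
       module.span cscale ((\<lambda>i. b i x) ` {..<m}) = qr_graph (P x))"
proof -
  note c = chart_at_mem[OF A, of p, folded c_def]
  obtain U1 k1 and e :: "nat \<Rightarrow> 'a \<Rightarrow> complex^'n" where U1: "open U1" "p \<in> U1"
    and e: "\<And>q. q \<in> U1 \<Longrightarrow> inj_on (\<lambda>i. e i q) {..<k1} \<and> vec.independent ((\<lambda>i. e i q) ` {..<k1}) \<and>
      vec.span ((\<lambda>i. e i q) ` {..<k1}) = E_dist \<pi> q"
    using reg unfolding strongly_regular_def smooth_subbundle_def by metis
  obtain U2 k and s :: "nat \<Rightarrow> 'a \<Rightarrow> real^'n" where U2: "open U2" "p \<in> U2"
    and ssec: "\<And>i. i < k \<Longrightarrow> smooth_section A act_TM U2 (s i)"
    and s: "\<And>q. q \<in> U2 \<Longrightarrow> inj_on (\<lambda>i. s i q) {..<k} \<and> independent ((\<lambda>i. s i q) ` {..<k}) \<and>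
      span ((\<lambda>i. s i q) ` {..<k}) = Delta_dist \<pi> q"
    using reg unfolding strongly_regular_def smooth_subbundle_def dependent_raw_def span_raw_def by metis
  define S where "S = snd c ` (fst c \<inter> (U1 \<inter> U2 \<inter> V))"
  have S: "open S" unfolding S_def
    by (rule chart_image_open[OF A c(1)]) (intro open_Int U1 U2 V)
  have x0: "snd c p \<in> S" using c U1 U2 V by (auto simp: S_def)
  have skew: "transpose (\<pi> q) = - \<pi> q" for q using poisson by (simp add: complex_poisson_def)
  have Pq: "P (snd c q) = act_biv (change_jac (chart_at A q) c q) (\<pi> q)" if "q \<in> fst c" for q
    unfolding P_def by (rule local_rep_chart[OF A c(1) that])
  have inv: "change_jac (chart_at A q) c q ** change_jac c (chart_at A q) q = mat 1"
    "change_jac c (chart_at A q) q ** change_jac (chart_at A q) c q = mat 1" if "q \<in> fst c" for q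
    using change_jac_inverse[OF A] c(1) that chart_at_mem[OF A, of q] by blast+
  have "smooth_on (snd c ` fst c) P"
    using poisson c(1) unfolding complex_poisson_def smooth_section_def P_def by auto
  then have "smooth_on S P" by (rule smooth_on_subset) (auto simp: S_def)
  then have Psm: "smooth_on S (\<lambda>x. P x $ i $ j)" for i j
    by (intro smooth_on_nth S)
  have dim: "vec.dim (range ((*v) (P x))) = k1" if x: "x \<in> S" for x
  proof -
    obtain q where q: "q \<in> fst c" "q \<in> U1" "x = snd c q" using x by (auto simp: S_def)
    let ?J = "change_jac (chart_at A q) c q" and ?J' = "change_jac c (chart_at A q) q"
    have "inj ((*v) (cmat ?J))"
      by (rule inj_on_inverseI[where g = "(*v) (cmat ?J')"])
         (simp add: matrix_vector_mul_assoc cmat_mult[symmetric] inv[OF q(1)])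
    then have "vec.dim (range ((*v) (P x))) = vec.dim (range ((*v) (\<pi> q)))"
      unfolding q(3) Pq[OF q(1)] range_act_biv[OF inv[OF q(1)]]
      by (intro vec.dim_image_eq[OF matrix_vector_mul_linear_gen]) (meson inj_on_subset subset_UNIV)
    also have "\<dots> = vec.dim (vec.span ((\<lambda>i. e i q) ` {..<k1}))"
      using e[OF q(2)] by (simp add: E_dist_def sharp_eq)
    also have "\<dots> = card ((\<lambda>i. e i q) ` {..<k1})"
      using e[OF q(2)] vec.dim_span_eq_card_independent by blast
    also have "\<dots> = k1" using e[OF q(2)] by (simp add: card_image)
    finally show ?thesis .
  qed
  define \<sigma> where "\<sigma> i = local_rep A act_TM c (s i)" for i
  have \<sigma>sm: "smooth_on S (\<sigma> i)" if "i < k" for i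
  proof -
    have "smooth_on (snd c ` (fst c \<inter> U2)) (\<sigma> i)"
      using ssec[OF that] c(1) unfolding smooth_section_def \<sigma>_def by blast
    then show ?thesis by (rule smooth_on_subset) (auto simp: S_def)
  qed
  have \<sigma>q: "\<sigma> i (snd c q) = change_jac (chart_at A q) c q *v s i q" if "q \<in> fst c" for i q
    unfolding \<sigma>_def by (simp add: local_rep_chart[OF A c(1) that] act_TM_def)
  \<comment> \<open>The chart chosen at \<open>p\<close> is \<open>c\<close>, so no conversion takes
    place there and independence at \<open>p\<close> carries over.\<close>
  have \<sigma>p: "\<sigma> i (snd c p) = s i p" for i
    using \<sigma>q[OF c(2)] change_jac_refl[OF A c] by (simp add: c_def)
  have span: "span ((\<lambda>i. \<sigma> i x) ` {..<k}) = {v. cvec v \<in> range ((*v) (P x))}" if x: "x \<in> S" for x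
  proof -
    obtain q where q: "q \<in> fst c" "q \<in> U2" "x = snd c q" using x by (auto simp: S_def)
    let ?J = "change_jac (chart_at A q) c q"
    have "(\<lambda>i. \<sigma> i x) ` {..<k} = (*v) ?J ` (\<lambda>i. s i q) ` {..<k}"
      by (auto simp: q(3) \<sigma>q[OF q(1)])
    then have "span ((\<lambda>i. \<sigma> i x) ` {..<k}) = (*v) ?J ` span ((\<lambda>i. s i q) ` {..<k})"
      by (simp only: linear_span_image[OF matrix_vector_mul_linear])
    also have "\<dots> = (*v) ?J ` {v. cvec v \<in> range ((*v) (\<pi> q))}"
      using s[OF q(2)] Delta_dist_iff[of _ \<pi> q] by auto
    finally show ?thesis
      unfolding q(3) Pq[OF q(1)] Delta_act[OF inv[OF q(1)]] .
  qed
  have Pskew: "transpose (P x) = - P x" if x: "x \<in> S" for x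
  proof -
    obtain q where q: "q \<in> fst c" "x = snd c q" using x by (auto simp: S_def)
    then show ?thesis using Pq[OF q(1)] act_biv_skew[OF skew] by simp
  qed
  have inj: "inj_on (\<lambda>j. \<sigma> j (snd c p)) {..<k}" and ind: "independent ((\<lambda>j. \<sigma> j (snd c p)) ` {..<k})"
    using s[OF U2(2)] by (simp_all add: \<sigma>p)
  have dim': "vec.dim (range ((*v) (P x))) = vec.dim (range ((*v) (P (snd c p))))" if "x \<in> S" for x
    using dim[OF that] dim[OF x0] by simp
  show ?thesis
  proof (rule qr_graph_local_structure[OF S x0 Psm Pskew dim' \<sigma>sm inj ind span])
    fix T assume T: "open T" "snd c p \<in> T" "T \<subseteq> S"
    assume lift: "\<And>X. smooth_on T X \<Longrightarrow> (\<And>x. x \<in> T \<Longrightarrow> X x \<in> range ((*v) (P x))) \<Longrightarrow>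
        \<exists>\<alpha>. smooth_on T \<alpha> \<and> (\<forall>x\<in>T. X x = P x *v \<alpha> x)"
      and ext: "\<And>Z0. Z0 \<in> real_core (P (snd c p)) \<Longrightarrow>
        \<exists>Z. smooth_on T Z \<and> Z (snd c p) = Z0 \<and> (\<forall>x\<in>T. Z x \<in> real_core (P x))"
      and frame: "\<exists>(m::nat) b. (\<forall>i<m. smooth_on T (b i)) \<and> (\<forall>x\<in>T. inj_on (\<lambda>i. b i x) {..<m} \<and>
         \<not> module.dependent cscale ((\<lambda>i. b i x) ` {..<m}) \<and>
         module.span cscale ((\<lambda>i. b i x) ` {..<m}) = qr_graph (P x))"
    show ?thesis
    proof (rule that[OF T(1,2) _ _ _ _ frame])
      show "T \<subseteq> snd c ` (fst c \<inter> V)" using T(3) by (auto simp: S_def)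
      show "smooth_on T (\<lambda>x. P x $ i $ j)" for i j by (rule smooth_on_subset[OF Psm T(3)])
    qed (intro allI impI ballI lift ext; blast)+
  qed
qed

theorem theorem7p18:
  fixes A :: "('a::{t2_space, second_countable_topology}, 'n::finite) chart set"
    and \<pi> :: "'a \<Rightarrow> complex^'n^'n"
  assumes "smooth_manifold A"
    and "complex_poisson A \<pi>"
  shows "(\<forall>p. quasi_real (biv_graph \<pi>) p =
            form_graph (complexify (Delta_dist \<pi> p)) (Omega_form \<pi> p)) \<and>
         (strongly_regular A \<pi> \<longrightarrow> complex_dirac A (quasi_real (biv_graph \<pi>)))"
proof (intro conjI allI impI)
  note A = assms(1)
  have skew: "transpose (\<pi> q) = - \<pi> q" for q using assms(2) by (simp add: complex_poisson_def)
  \<comment> \<open>The common description by \<open>qr_graph\<close> settles the first claim and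
    replaces the family in the second.\<close>
  have qr: "quasi_real (biv_graph \<pi>) = (\<lambda>p. qr_graph (\<pi> p))"
    by (rule ext) (rule quasi_real_eq_qr_graph[where \<pi> = \<pi>, OF skew])
  show "quasi_real (biv_graph \<pi>) p = form_graph (complexify (Delta_dist \<pi> p)) (Omega_form \<pi> p)" for p
    by (simp only: qr form_graph_eq_qr_graph[where \<pi> = \<pi> and p = p, OF skew])
  assume reg: "strongly_regular A \<pi>"
  have inv: "change_jac (chart_at A q) c q ** change_jac c (chart_at A q) q = mat 1"
    "change_jac c (chart_at A q) q ** change_jac (chart_at A q) c q = mat 1" if "c \<in> A" "q \<in> fst c" for c q
    using change_jac_inverse[OF A] that chart_at_mem[OF A, of q] by blast+
  show "complex_dirac A (quasi_real (biv_graph \<pi>))"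
    unfolding complex_dirac_def qr
  proof (intro conjI allI)
    show "lagrangian (qr_graph (\<pi> p))" for p by (rule lagrangian_qr_graph[OF skew])
    show "smooth_subbundle A act_GTCM cscale (\<lambda>p. qr_graph (\<pi> p))"
      unfolding smooth_subbundle_def
    proof
      fix p
      let ?c = "chart_at A p"
      let ?P = "local_rep A act_biv ?c \<pi>"
      note c = chart_at_mem[OF A, of p]
      obtain T where T: "open T" "snd ?c p \<in> T" "T \<subseteq> snd ?c ` (fst ?c \<inter> UNIV)"
        and fr: "\<exists>(m::nat) b. (\<forall>i<m. smooth_on T (b i)) \<and> (\<forall>x\<in>T. inj_on (\<lambda>i. b i x) {..<m} \<and>
          \<not> module.dependent cscale ((\<lambda>i. b i x) ` {..<m}) \<and>
          module.span cscale ((\<lambda>i. b i x) ` {..<m}) = qr_graph (?P x))"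
        by (rule strongly_regular_local[OF A assms(2) reg open_UNIV UNIV_I, of p]) (rule that; assumption)
      obtain m :: nat and b where bsm: "\<And>i. i < m \<Longrightarrow> smooth_on T (b i)"
        and b: "\<And>x. x \<in> T \<Longrightarrow> inj_on (\<lambda>i. b i x) {..<m} \<and>
          \<not> module.dependent cscale ((\<lambda>i. b i x) ` {..<m}) \<and>
          module.span cscale ((\<lambda>i. b i x) ` {..<m}) = qr_graph (?P x)"
        using fr by blast
      define U where "U = {q \<in> fst ?c. snd ?c q \<in> T}"
      have U: "open U" unfolding U_def by (rule chart_preimage_open[OF A c(1) T(1)])
      have UT: "snd ?c ` U \<subseteq> T" by (auto simp: U_def)
      \<comment> \<open>The coordinate frame is converted, point by point, into the chart chosen at
        \<open>q\<close>.\<close>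
      define s where "s i q = act_GTCM (change_jac ?c (chart_at A q) q) (b i (snd ?c q))" for i q
      have "smooth_section A act_GTCM U (s i)" if "i < m" for i
        unfolding s_def
        by (rule smooth_section_from_chart[OF A c(1) U _ smooth_on_subset[OF bsm[OF that] UT]])
           (auto simp: U_def)
      moreover have "inj_on (\<lambda>i. s i q) {..<m} \<and> \<not> module.dependent cscale ((\<lambda>i. s i q) ` {..<m}) \<and>
          module.span cscale ((\<lambda>i. s i q) ` {..<m}) = qr_graph (\<pi> q)" if q: "q \<in> U" for q
      proof -
        have qc: "q \<in> fst ?c" "snd ?c q \<in> T" using q by (auto simp: U_def)
        let ?J = "change_jac ?c (chart_at A q) q"
        note J = inv(2,1)[OF c(1) qc(1)]
        interpret l: Vector_Spaces.linear cscale cscale "act_GTCM ?J" by (rule act_GTCM_linear)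
        have inj: "inj (act_GTCM ?J)" by (rule act_GTCM_inj[OF J])
        have im: "(\<lambda>i. s i q) ` {..<m} = act_GTCM ?J ` (\<lambda>i. b i (snd ?c q)) ` {..<m}"
          by (auto simp: s_def)
        \<comment> \<open>Converting \<pi> into the chart and back is the identity, so the converted
          frame spans the fibre over \<open>\<pi> q\<close>.\<close>
        have "act_biv ?J (?P (snd ?c q)) = \<pi> q"
          by (simp add: local_rep_chart[OF A c(1) qc(1)] act_biv_mult[symmetric] J)
        then have q: "act_GTCM ?J ` qr_graph (?P (snd ?c q)) = qr_graph (\<pi> q)"
          by (simp add: qr_graph_act_image[OF J])
        have "inj_on (\<lambda>i. s i q) {..<m}"
          unfolding s_def using b[OF qc(2)] inj by (meson inj_on_def injD)
        moreover have "\<not> module.dependent cscale ((\<lambda>i. s i q) ` {..<m})"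
          unfolding im using b[OF qc(2)] inj
          by (intro l.independent_injective_image) (auto intro: inj_on_subset)
        moreover have "module.span cscale ((\<lambda>i. s i q) ` {..<m}) = qr_graph (\<pi> q)"
          unfolding im l.span_image using b[OF qc(2)] q by simp
        ultimately show ?thesis by blast
      qed
      moreover have "p \<in> U" using c T by (simp add: U_def)
      ultimately show "\<exists>U k (s :: nat \<Rightarrow> 'a \<Rightarrow> _). open U \<and> p \<in> U \<and> (\<forall>i<k. smooth_section A act_GTCM U (s i)) \<and>
        (\<forall>q\<in>U. inj_on (\<lambda>i. s i q) {..<k} \<and> \<not> module.dependent cscale ((\<lambda>i. s i q) ` {..<k}) \<and>
               module.span cscale ((\<lambda>i. s i q) ` {..<k}) = qr_graph (\<pi> q))"
        using U by (intro exI[of _ U] exI[of _ m] exI[of _ s]) blast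
    qed
    show "involutive A (\<lambda>p. qr_graph (\<pi> p))"
      unfolding involutive_def
    proof (intro allI impI ballI)
      fix U s t p
      assume H: "open U \<and> smooth_section A act_GTCM U s \<and> smooth_section A act_GTCM U t \<and>
        (\<forall>p\<in>U. s p \<in> qr_graph (\<pi> p) \<and> t p \<in> qr_graph (\<pi> p))" and p: "p \<in> U"
      let ?c = "chart_at A p"
      let ?P = "local_rep A act_biv ?c \<pi>"
      note c = chart_at_mem[OF A, of p]
      \<comment> \<open>\<open>T\<close> is taken inside the image of \<open>U\<close>, where the
        sections are smooth and lie in the family.\<close>
      obtain T where T: "open T" "snd ?c p \<in> T" "T \<subseteq> snd ?c ` (fst ?c \<inter> U)"
        and Psm: "\<And>i j. smooth_on T (\<lambda>x. ?P x $ i $ j)"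
        and lift: "\<forall>X. smooth_on T X \<longrightarrow> (\<forall>x\<in>T. X x \<in> range ((*v) (?P x))) \<longrightarrow>
          (\<exists>\<alpha>. smooth_on T \<alpha> \<and> (\<forall>x\<in>T. X x = ?P x *v \<alpha> x))"
        and ext: "\<forall>Z0\<in>real_core (?P (snd ?c p)).
          \<exists>Z. smooth_on T Z \<and> Z (snd ?c p) = Z0 \<and> (\<forall>x\<in>T. Z x \<in> real_core (?P x))"
        by (rule strongly_regular_local[OF A assms(2) reg conjunct1[OF H] p]) (rule that; assumption)
      have loc: "transpose (?P x) = - ?P x"
        "v q \<in> qr_graph (\<pi> q) \<Longrightarrow> local_rep A act_GTCM ?c v x \<in> qr_graph (?P x)"
        if "q \<in> fst ?c" "x = snd ?c q" for q x v
        unfolding that(2) local_rep_chart[OF A c(1) that(1)]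
        by (rule act_biv_skew[OF skew], rule qr_graph_act[OF inv[OF c(1) that(1)]])
      have TQ: "\<exists>q. q \<in> fst ?c \<and> q \<in> U \<and> x = snd ?c q" if "x \<in> T" for x using that T(3) by blast
      have "courant_coord (local_rep A act_GTCM ?c s) (local_rep A act_GTCM ?c t) (snd ?c p) \<in> qr_graph (?P (snd ?c p))"
      proof (rule courant_coord_qr_graph[OF T(1,2) Psm _ _ lift[rule_format] ext[rule_format]])
        show "transpose (?P x) = - ?P x" if "x \<in> T" for x using TQ[OF that] loc(1) by blast
        show "schouten_coord ?P ?P (snd ?c p) i j k = 0" for i j k
          using assms(2) unfolding complex_poisson_def schouten_def Let_def by blast
        show "smooth_on T (local_rep A act_GTCM ?c s)" "smooth_on T (local_rep A act_GTCM ?c t)"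
          using H c(1) T(3) unfolding smooth_section_def by (blast intro: smooth_on_subset)+
        show "local_rep A act_GTCM ?c s x \<in> qr_graph (?P x)" "local_rep A act_GTCM ?c t x \<in> qr_graph (?P x)" if "x \<in> T" for x
          using TQ[OF that] loc(2) H by blast+
      qed
      \<comment> \<open>The bracket at \<open>p\<close> is computed in this very chart, and there
        the conversion at \<open>p\<close> is the identity.\<close>
      then show "courant A s t p \<in> qr_graph (\<pi> p)"
        using local_rep_chart[OF A c, of act_biv \<pi>] change_jac_refl[OF A c]
        by (simp add: courant_def Let_def)
    qed
  qed
qed

end
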